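(* Let $n\ge1$ and $\sigma,\sigma'\in S_n$ with $\sigma\preceq_L\sigma'$. Then $|C_\sigma|\le|C_{\sigma'}|$.
   Context: $s_i$ denotes the simple transposition $(i\ i+1)$ and $l(\cdot)$ the Coxeter length in $S_n$. The (left) order $\preceq_L$ on $S_n$: $u\preceq_L w$ if $w=s_{i_1}\cdots s_{i_k}u$ with $l(s_{i_1}\cdots s_{i_k}u)=l(u)+k$. Identify a monotone lattice path from $(0,0)$ to $(n-k,k)$ with the $k$-subset of $[n]$ of positions of its North steps. For $k$-subsets $U=\{u_1<\dots<u_k\}$, $L=\{\ell_1<\dots<\ell_k\}$ of $[n]$ with $u_i\le\ell_i$ for all $i$, the lattice path matroid $M[U,L]$ is the matroid on $[n]$ whose bases are the $k$-sets $\{b_1<\dots<b_k\}$ with $u_i\le b_i\le\ell_i$. $\mathcal{P}_n$ is the poset of all lattice path matroids on $[n]$ ordered by the matroid quotient relation ($M'\le_q M$ iff there is a matroid $N$ on $[n]\sqcup T$ with $M=N\setminus T$, $M'=N/T$). Known: $M[U',L']\le_q M[U,L]$ iff $U'\subseteq U$, $L'\subseteq L$ and the greedy pairing is good, where: $(\ell_i,u_j)$ is a good pair of $M[U,L]$ if $i\le j$ and $u_j-\ell_i\le j-i$; with $U\setminus U'=\{a_1<\dots<a_z\}$, $L\setminus L'=\{b_1<\dots<b_z\}$, the greedy pairing $((b_1,a_1),\dots,(b_z,a_z))$ is good if each $(b_r,a_r)$ is a good pair of $M[U\setminus\{a_1,\dots,a_{r-1}\},L\setminus\{b_1,\dots,b_{r-1}\}]$.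 Covers $M[U\setminus\{u\},L\setminus\{\ell\}]\lessdot M[U,L]$ are labeled $(\ell,u)$. A maximal chain $M[\emptyset,\emptyset]=M_0\lessdot\cdots\lessdot M_n=M[[n],[n]]$ has label sequence $((\ell_1,u_1),\dots,(\ell_n,u_n))$ with $(\ell_i,u_i)=\lambda(M_{i-1}\lessdot M_i)$, and is falling if for each $1\le i<n$ it is not the case that both $\ell_i<\ell_{i+1}$ and $u_i<u_{i+1}$. For $\sigma,\tau\in S_n$, $C_{(\sigma,\tau)}=((\sigma(1),\tau(1)),\dots,(\sigma(n),\tau(n)))$, and $C_\sigma$ is the set of those $C_{(\sigma,\tau)}$, $\tau\in S_n$, that are label sequences of falling maximal chains of $\mathcal{P}_n$. *)

theory Defs
  imports "HOL-Combinatorics.Permutations"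
begin

section \<open>Matroids given by their bases\<close>

datatype 'a basis_system = Basis_System (ground: "'a set") (bases: "'a set set")

definition is_matroid :: "'a basis_system \<Rightarrow> bool" where
  "is_matroid M \<longleftrightarrow>
     finite (ground M) \<and> bases M \<noteq> {} \<and> (\<forall>B\<in>bases M. B \<subseteq> ground M) \<and>
     (\<forall>A\<in>bases M. \<forall>B\<in>bases M. \<forall>x\<in>A - B. \<exists>y\<in>B - A. insert y (A - {x}) \<in> bases M)"

definition indep :: "'a basis_system \<Rightarrow> 'a set \<Rightarrow> bool" where
  "indep M I \<longleftrightarrow> (\<exists>B\<in>bases M. I \<subseteq> B)"

definition delete :: "'a basis_system \<Rightarrow> 'a set \<Rightarrow> 'a basis_system" where
  "delete M T = Basis_System (ground M - T)
     {I. indep M I \<and> I \<inter> T = {} \<and> (\<forall>J. indep M J \<and> J \<inter> T = {} \<and> I \<subseteq> J \<longrightarrow> J = I)}"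

definition dual :: "'a basis_system \<Rightarrow> 'a basis_system" where
  "dual M = Basis_System (ground M) ((\<lambda>B. ground M - B) ` bases M)"

definition contract :: "'a basis_system \<Rightarrow> 'a set \<Rightarrow> 'a basis_system" where
  "contract M T = dual (delete (dual M) T)"

text \<open>
  The auxiliary set \<open>T\<close> is finite, so any such set disjoint from a finite ground set of
  natural numbers can be renamed into the natural numbers; restricting to
  \<open>T :: nat set\<close> loses nothing.
\<close>

definition quotient_le :: "nat basis_system \<Rightarrow> nat basis_system \<Rightarrow> bool" where
  "quotient_le M' M \<longleftrightarrow>
     (\<exists>N T. is_matroid N \<and> finite T \<and> ground M \<inter> T = {} \<and> ground N = ground M \<union> T \<and>
            M = delete N T \<and> M' = contract N T)"

section \<open>Lattice path matroids\<close>

text \<open>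
  Lattice paths are represented by the sets of positions of their North steps.  The lists
  below are indexed from 0, so \<open>sorted_list_of_set U ! i\<close> is $u_{i+1}$.
\<close>

definition path_pair :: "nat \<Rightarrow> nat set \<Rightarrow> nat set \<Rightarrow> bool" where
  "path_pair n U L \<longleftrightarrow>
     U \<subseteq> {1..n} \<and> L \<subseteq> {1..n} \<and> card U = card L \<and>
     (\<forall>i<card U. sorted_list_of_set U ! i \<le> sorted_list_of_set L ! i)"

definition lpm :: "nat \<Rightarrow> nat set \<Rightarrow> nat set \<Rightarrow> nat basis_system" where
  "lpm n U L = Basis_System {1..n}
     {B. B \<subseteq> {1..n} \<and> card B = card U \<and>
         (\<forall>i<card U. sorted_list_of_set U ! i \<le> sorted_list_of_set B ! i \<and>
                     sorted_list_of_set B ! i \<le> sorted_list_of_set L ! i)}"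

definition lpms :: "nat \<Rightarrow> nat basis_system set" where
  "lpms n = {lpm n U L | U L. path_pair n U L}"

definition covered_by :: "nat \<Rightarrow> nat basis_system \<Rightarrow> nat basis_system \<Rightarrow> bool" where
  "covered_by n M' M \<longleftrightarrow>
     M' \<in> lpms n \<and> M \<in> lpms n \<and> M' \<noteq> M \<and> quotient_le M' M \<and>
     (\<forall>K\<in>lpms n. quotient_le M' K \<and> quotient_le K M \<longrightarrow> K = M' \<or> K = M)"

text \<open>
  The label of a cover is given as a relation.  The pair \<open>(U, L)\<close> is determined by the
  matroid (its componentwise least and greatest bases), hence so is the label.
\<close>

definition cover_label ::
  "nat \<Rightarrow> nat basis_system \<Rightarrow> nat basis_system \<Rightarrow> nat \<times> nat \<Rightarrow> bool" where
  "cover_label n M' M lab \<longleftrightarrow>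
     covered_by n M' M \<and>
     (\<exists>U L l u. lab = (l, u) \<and> path_pair n U L \<and> M = lpm n U L \<and> u \<in> U \<and> l \<in> L \<and>
                path_pair n (U - {u}) (L - {l}) \<and> M' = lpm n (U - {u}) (L - {l}))"

definition maximal_chain :: "nat \<Rightarrow> (nat \<Rightarrow> nat basis_system) \<Rightarrow> bool" where
  "maximal_chain n M \<longleftrightarrow>
     M 0 = lpm n {} {} \<and> M n = lpm n {1..n} {1..n} \<and>
     (\<forall>i\<in>{1..n}. covered_by n (M (i - 1)) (M i))"

text \<open>Entry \<open>ls ! (i - 1)\<close> is the label of the cover from \<open>M (i - 1)\<close> to \<open>M i\<close>.\<close>

definition label_sequence ::
  "nat \<Rightarrow> (nat \<Rightarrow> nat basis_system) \<Rightarrow> (nat \<times> nat) list \<Rightarrow> bool" where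
  "label_sequence n M ls \<longleftrightarrow>
     length ls = n \<and> (\<forall>i\<in>{1..n}. cover_label n (M (i - 1)) (M i) (ls ! (i - 1)))"

definition falling :: "(nat \<times> nat) list \<Rightarrow> bool" where
  "falling ls \<longleftrightarrow>
     (\<forall>i. Suc i < length ls \<longrightarrow>
        \<not> (fst (ls ! i) < fst (ls ! Suc i) \<and> snd (ls ! i) < snd (ls ! Suc i)))"

definition perm_pair_seq :: "nat \<Rightarrow> (nat \<Rightarrow> nat) \<Rightarrow> (nat \<Rightarrow> nat) \<Rightarrow> (nat \<times> nat) list" where
  "perm_pair_seq n \<sigma> \<tau> = map (\<lambda>i. (\<sigma> i, \<tau> i)) [1..<Suc n]"

definition falling_class :: "nat \<Rightarrow> (nat \<Rightarrow> nat) \<Rightarrow> (nat \<times> nat) list set" where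
  "falling_class n \<sigma> =
     {perm_pair_seq n \<sigma> \<tau> | \<tau>. \<tau> permutes {1..n} \<and>
        (\<exists>M. maximal_chain n M \<and> label_sequence n M (perm_pair_seq n \<sigma> \<tau>)) \<and>
        falling (perm_pair_seq n \<sigma> \<tau>)}"

section \<open>Left weak order\<close>

text \<open>
  Products of permutations are compositions of functions, rightmost factor first, so left
  multiplication by a simple transposition acts on the values.
\<close>

definition simple_word_perm :: "nat list \<Rightarrow> nat \<Rightarrow> nat" where
  "simple_word_perm is = foldr (\<lambda>i w. transpose i (Suc i) \<circ> w) is id"

definition coxeter_length :: "nat \<Rightarrow> (nat \<Rightarrow> nat) \<Rightarrow> nat" where
  "coxeter_length n w =
     (LEAST k. \<exists>is. length is = k \<and> set is \<subseteq> {1..<n} \<and> w = simple_word_perm is)"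

definition left_weak_le :: "nat \<Rightarrow> (nat \<Rightarrow> nat) \<Rightarrow> (nat \<Rightarrow> nat) \<Rightarrow> bool" where
  "left_weak_le n u w \<longleftrightarrow>
     (\<exists>is. set is \<subseteq> {1..<n} \<and> w = simple_word_perm is \<circ> u \<and>
           coxeter_length n w = coxeter_length n u + length is)"

end

(*
  The cover from M[U, L] to M[U + u, L + l] exists iff (l, u) is a good pair.  If it is good, the
  bases of the larger matroid together with the bases of the smaller one extended by a new element
  form a matroid N, which exhibits the quotient.  If it is not, some basis of the larger matroid
  contains no basis of the smaller one, or some basis of the smaller one lies in no basis of the
  larger one: take a lattice path that touches both boundaries in the wrong order.
  So C_sigma corresponds to the tau satisfying a step-by-step counting condition on (sigma, tau)
  together with the falling condition.  Swapping the values i and i + 1 in sigma, where i occurs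
  before i + 1, preserves both conditions for the same tau.  Since Coxeter length counts
  inversions, every step of a left weak order chain is such a swap.
*)

theory Submission
  imports Defs
begin

section \<open>Counting functions\<close>

text \<open>Sorted indices are awkward here: inserting one element shifts all later ones.
  \<open>cnt S m\<close>, the height of the lattice path of \<open>S\<close> after \<open>m\<close>
  steps, avoids this. Insertion adds 1 to the height from one point on, and the componentwise order
  turns into the reversed pointwise order of heights, so the bases are the paths inside a strip. The
  two inequalities of a good pair guard opposite passages. \<open>cnt L l \<le> cnt U u\<close> lets
  a larger basis be thinned out to a smaller one; it can fail only if \<open>u < l\<close>.
  \<open>u + cnt L l \<le> l + cnt U u\<close> lets a smaller basis grow to a larger one; it can
  fail only if \<open>l < u\<close>.\<close>

definition cnt :: "nat set \<Rightarrow> nat \<Rightarrow> nat" where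
  "cnt S m = card (S \<inter> {..m})"

lemma cnt_mono: "m \<le> m' \<Longrightarrow> cnt S m \<le> cnt S m'"
  unfolding cnt_def by (rule card_mono) auto

lemma cnt_insert: "x \<notin> S \<Longrightarrow> cnt (insert x S) m = cnt S m + of_bool (x \<le> m)"
  unfolding cnt_def by (auto simp: Int_insert_left)

lemma cnt_remove: "x \<in> S \<Longrightarrow> cnt S m = cnt (S - {x}) m + of_bool (x \<le> m)"
  using cnt_insert[of x "S - {x}" m] by (simp add: insert_absorb)

lemma cnt_0: "S \<subseteq> {1..n} \<Longrightarrow> cnt S 0 = 0"
  unfolding cnt_def by (auto simp: card_eq_0_iff)

lemma cnt_ge: "S \<subseteq> {1..n} \<Longrightarrow> n \<le> m \<Longrightarrow> cnt S m = card S"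
  unfolding cnt_def by (rule arg_cong[where f = card]) fastforce

lemma cnt_eq_add:
  assumes "q \<le> p"
  shows "cnt S p = cnt S q + card (S \<inter> {q<..p})"
proof -
  have "S \<inter> {..p} = (S \<inter> {..q}) \<union> (S \<inter> {q<..p})" using assms by auto
  moreover have "card ((S \<inter> {..q}) \<union> (S \<inter> {q<..p})) = card (S \<inter> {..q}) + card (S \<inter> {q<..p})"
    by (rule card_Un_disjoint) auto
  ultimately show ?thesis unfolding cnt_def by simp
qed

lemma cnt_le_add: "q \<le> p \<Longrightarrow> cnt S p \<le> cnt S q + (p - q)"
proof -
  assume "q \<le> p"
  have "card (S \<inter> {q<..p}) \<le> card {q<..p}" by (rule card_mono) auto
  then show ?thesis using cnt_eq_add[OF \<open>q \<le> p\<close>, of S] by simp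
qed

lemma cnt_Suc: "cnt S (Suc m) = cnt S m + of_bool (Suc m \<in> S)"
proof -
  have "S \<inter> {m<..Suc m} = (if Suc m \<in> S then {Suc m} else {})"
    by (auto simp: le_Suc_eq)
  then show ?thesis using cnt_eq_add[of m "Suc m" S] by (auto split: if_splits)
qed

lemma cnt_inject:
  assumes "S \<subseteq> {1..n}" "T \<subseteq> {1..n'}" "\<And>m. cnt S m = cnt T m"
  shows "S = T"
proof -
  have "x \<in> S \<longleftrightarrow> x \<in> T" for x
  proof (cases x)
    case 0
    then show ?thesis using assms(1,2) by auto
  next
    case (Suc m)
    then show ?thesis
      using cnt_Suc[of S m] cnt_Suc[of T m] assms(3)[of m] assms(3)[of x]
      by (cases "Suc m \<in> S"; cases "Suc m \<in> T") auto
  qed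
  then show ?thesis by blast
qed

text \<open>The source of every exchange element below: a path that climbs strictly more over
  \<open>{q<..p}\<close> has a North step there that the other path lacks.\<close>

lemma cnt_less_obtains:
  assumes "q \<le> p" "cnt A p + cnt B q < cnt B p + cnt A q"
  obtains y where "y \<in> B - A" "q < y" "y \<le> p"
proof -
  have "\<not> B \<inter> {q<..p} \<subseteq> A \<inter> {q<..p}"
  proof
    assume "B \<inter> {q<..p} \<subseteq> A \<inter> {q<..p}"
    then have "card (B \<inter> {q<..p}) \<le> card (A \<inter> {q<..p})" by (intro card_mono) auto
    then show False using assms(2) cnt_eq_add[OF assms(1), of A] cnt_eq_add[OF assms(1), of B] by linarith
  qed
  then obtain y where "y \<in> B \<inter> {q<..p}" "y \<notin> A" by blast
  then show ?thesis using that[of y] by simp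
qed

text \<open>Dropping \<open>x\<close> lowers the climb of \<open>A\<close> by one, so the weak
  inequality becomes strict; \<open>y\<close> differs from \<open>x\<close> because
  \<open>x \<notin> B\<close>.\<close>

lemma cnt_le_obtains:
  assumes "x \<in> A - B" "q < x" "x \<le> p" "cnt A p + cnt B q \<le> cnt B p + cnt A q"
  obtains y where "y \<in> B - A" "q < y" "y \<le> p"
proof -
  have "cnt (A - {x}) p + cnt B q < cnt B p + cnt (A - {x}) q"
    using assms cnt_remove[of x A p] cnt_remove[of x A q] by auto
  then obtain y where "y \<in> B - (A - {x})" "q < y" "y \<le> p"
    using cnt_less_obtains[of q p] assms(2,3) by (metis less_le_trans less_imp_le)
  then show ?thesis using that assms(1) by blast
qed

text \<open>Since the list is sorted, the indices of elements up to \<open>m\<close> form an initial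
  segment, whose length is the height at \<open>m\<close>. Counting indices from 0 makes the
  inequality on the right strict.\<close>

lemma sorted_list_of_set_nth_le_iff:
  assumes "finite S" "i < card S"
  shows "sorted_list_of_set S ! i \<le> m \<longleftrightarrow> i < cnt S m"
proof -
  let ?xs = "sorted_list_of_set S"
  let ?J = "{j. j < card S \<and> ?xs ! j \<le> m}"
  have len: "length ?xs = card S" by simp
  have mono: "?xs ! j \<le> ?xs ! k" if "j \<le> k" "k < card S" for j k
    using that by (intro sorted_nth_mono) auto
  have "S \<inter> {..m} = (\<lambda>j. ?xs ! j) ` ?J"
  proof -
    have "S = (\<lambda>j. ?xs ! j) ` {j. j < card S}"
      using assms(1) len by (metis set_sorted_list_of_set set_conv_nth image_Collect setcompr_eq_image)
    then show ?thesis by auto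
  qed
  moreover have "inj_on (\<lambda>j. ?xs ! j) ?J"
    by (rule inj_onI) (metis (no_types, lifting) distinct_sorted_list_of_set len mem_Collect_eq nth_eq_iff_index_eq)
  ultimately have cnt: "cnt S m = card ?J" unfolding cnt_def by (simp add: card_image)
  have fin: "finite ?J" by simp
  show ?thesis
  proof
    assume "?xs ! i \<le> m"
    then have "{..i} \<subseteq> ?J" using mono[of _ i] assms(2) by (auto intro: order_trans)
    from card_mono[OF fin this] show "i < cnt S m" using cnt by simp
  next
    assume *: "i < cnt S m"
    show "?xs ! i \<le> m"
    proof (rule ccontr)
      assume "\<not> ?xs ! i \<le> m"
      then have "?J \<subseteq> {..<i}" using mono[of i] by (auto simp: not_le) (meson leI le_less_trans not_le order_trans)
      from card_mono[OF _ this] show False using cnt * by simp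
    qed
  qed
qed

lemma sorted_list_of_set_le_iff_cnt:
  assumes "finite S" "finite T" "card S = card T"
  shows "(\<forall>i<card S. sorted_list_of_set S ! i \<le> sorted_list_of_set T ! i) \<longleftrightarrow> (\<forall>m. cnt T m \<le> cnt S m)"
    (is "?l \<longleftrightarrow> ?r")
proof
  assume l: ?l
  show ?r
  proof
    fix m
    show "cnt T m \<le> cnt S m"
    proof (rule ccontr)
      assume *: "\<not> cnt T m \<le> cnt S m"
      \<comment> \<open>At this index the element of \<open>S\<close> is the first beyond
        \<open>m\<close>, while that of \<open>T\<close> is still at most \<open>m\<close>.\<close>
      let ?i = "cnt S m"
      have "cnt T m \<le> card T" unfolding cnt_def using assms by (intro card_mono) auto
      then have i: "?i < card T" using * by simp
      then have "sorted_list_of_set T ! ?i \<le> m"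
        using sorted_list_of_set_nth_le_iff[OF assms(2), of ?i m] * by simp
      then have "sorted_list_of_set S ! ?i \<le> m" using l i assms(3) order_trans by metis
      then show False using sorted_list_of_set_nth_le_iff[OF assms(1), of ?i m] i assms(3) by simp
    qed
  qed
next
  assume r: ?r
  then show ?l
    using sorted_list_of_set_nth_le_iff[OF assms(1)] sorted_list_of_set_nth_le_iff[OF assms(2)] assms(3)
    by (metis order_refl order_less_le_trans)
qed

section \<open>Lattice path matroids\<close>

definition strip :: "nat \<Rightarrow> (nat \<Rightarrow> nat) \<Rightarrow> (nat \<Rightarrow> nat) \<Rightarrow> nat set set" where
  "strip n lo up = {B. B \<subseteq> {1..n} \<and> (\<forall>m. lo m \<le> cnt B m \<and> cnt B m \<le> up m)}"

lemma path_pair_iff_cnt: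
  "path_pair n U L \<longleftrightarrow>
     U \<subseteq> {1..n} \<and> L \<subseteq> {1..n} \<and> card U = card L \<and> (\<forall>m. cnt L m \<le> cnt U m)"
  unfolding path_pair_def using sorted_list_of_set_le_iff_cnt
  by (metis finite_atLeastAtMost finite_subset)

lemma bases_lpm:
  assumes "path_pair n U L"
  shows "bases (lpm n U L) = strip n (cnt L) (cnt U)"
proof -
  have UL: "U \<subseteq> {1..n}" "L \<subseteq> {1..n}" "card U = card L" and fin: "finite U" "finite L"
    using assms finite_subset unfolding path_pair_def by blast+
  have "B \<in> bases (lpm n U L) \<longleftrightarrow> B \<in> strip n (cnt L) (cnt U)" for B
  proof (cases "B \<subseteq> {1..n} \<and> card B = card U")
    case True
    then have B: "finite B" "card B = card U" using finite_subset by blast+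
    then show ?thesis
      using True sorted_list_of_set_le_iff_cnt[OF fin(1) B(1)]
        sorted_list_of_set_le_iff_cnt[OF B(1) fin(2)] UL
      unfolding lpm_def strip_def by auto
  next
    case False
    \<comment> \<open>At \<open>n\<close> both boundaries have height \<open>card U\<close>, which
      forces the size of every set in the strip.\<close>
    moreover have "B \<notin> strip n (cnt L) (cnt U)"
      using False UL cnt_ge[of _ n n] unfolding strip_def
      by simp (metis le_antisym order_refl)
    ultimately show ?thesis unfolding lpm_def by auto
  qed
  then show ?thesis by blast
qed

lemma ground_lpm [simp]: "ground (lpm n U L) = {1..n}"
  by (simp add: lpm_def)

lemma card_bases_lpm: "B \<in> bases (lpm n U L) \<Longrightarrow> card B = card U"
  by (simp add: lpm_def)

lemma upper_in_bases_lpm: "path_pair n U L \<Longrightarrow> U \<in> bases (lpm n U L)"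
  by (simp add: bases_lpm strip_def path_pair_iff_cnt)

lemma lower_in_bases_lpm: "path_pair n U L \<Longrightarrow> L \<in> bases (lpm n U L)"
  by (simp add: bases_lpm strip_def path_pair_iff_cnt)

text \<open>The boundaries are themselves bases, so each pair lies inside the strip of the other and
  the heights are squeezed together.\<close>

lemma lpm_inject:
  assumes "path_pair n U L" "path_pair n U' L'" "lpm n U L = lpm n U' L'"
  shows "U = U'" "L = L'"
proof -
  have eq: "strip n (cnt L) (cnt U) = strip n (cnt L') (cnt U')"
    using assms bases_lpm by metis
  have sub: "U \<subseteq> {1..n}" "L \<subseteq> {1..n}" "U' \<subseteq> {1..n}" "L' \<subseteq> {1..n}"
    using assms by (auto simp: path_pair_iff_cnt)
  have "{U, L} \<subseteq> strip n (cnt L') (cnt U')" "{U', L'} \<subseteq> strip n (cnt L) (cnt U)"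
    using assms eq bases_lpm upper_in_bases_lpm lower_in_bases_lpm by auto
  then have "cnt U m = cnt U' m" "cnt L m = cnt L' m" for m
    unfolding strip_def by (auto intro: le_antisym)
  then show "U = U'" "L = L'" using cnt_inject sub by blast+
qed

lemma lpms_eqI:
  assumes "M \<in> lpms n" "M' \<in> lpms n" "bases M = bases M'"
  shows "M = M'"
  using assms unfolding lpms_def by (auto intro: basis_system.expand)

section \<open>Consequences of the quotient relation\<close>

text \<open>\<open>A\<close> is maximal among the independent sets avoiding \<open>T\<close>, and
  \<open>B - T\<close> is such a set containing it.\<close>

lemma bases_delete_eq:
  assumes "A \<in> bases (delete N T)" "B \<in> bases N" "A \<subseteq> B"
  shows "A = B - T"
proof -
  have "indep N (B - T)" "A \<inter> T = {}"
    using assms unfolding indep_def delete_def by auto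
  then have "A \<subseteq> B - T" using assms by auto
  with \<open>indep N (B - T)\<close> show ?thesis using assms(1) unfolding delete_def by auto
qed

lemma obtain_basis_delete:
  assumes "finite (ground N)" "\<forall>B\<in>bases N. B \<subseteq> ground N" "indep N I" "I \<inter> T = {}"
  obtains A where "A \<in> bases (delete N T)" "I \<subseteq> A"
proof -
  let ?S = "{J. indep N J \<and> J \<inter> T = {}}"
  have "finite ?S"
    using assms(1,2) by (intro finite_subset[of ?S "Pow (ground N)"]) (auto simp: indep_def)
  moreover have "I \<in> ?S" using assms by simp
  ultimately obtain A where "A \<in> ?S" "I \<subseteq> A" "\<forall>J\<in>?S. A \<subseteq> J \<longrightarrow> A = J"
    using finite_has_maximal2[of ?S I] by auto
  then have "A \<in> bases (delete N T)" unfolding delete_def by auto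
  then show ?thesis using that \<open>I \<subseteq> A\<close> by blast
qed

context
  fixes M' M :: "nat basis_system"
  assumes quot: "quotient_le M' M"
begin

text \<open>Dualizing twice shows that a basis of the contraction lies in some basis
  \<open>B\<close> of \<open>N\<close> and avoids \<open>T\<close>; hence it is independent in the
  deletion. This and the next lemma are all that is ever extracted from a given quotient.\<close>

lemma quotient_basis_extends:
  assumes "A' \<in> bases M'"
  obtains A where "A \<in> bases M" "A' \<subseteq> A"
proof -
  obtain N T where N: "is_matroid N" "M = delete N T" "M' = contract N T"
    using quot unfolding quotient_le_def by blast
  obtain D where D: "D \<in> bases (delete (dual N) T)" "A' = ground N - T - D"
    using assms N(3) unfolding contract_def dual_def delete_def by auto
  then obtain B where B: "B \<in> bases N" "D \<subseteq> ground N - B"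
    unfolding delete_def indep_def dual_def by auto
  then have "ground N - B \<in> bases (dual N)" by (simp add: dual_def)
  then have "D = ground N - B - T" using bases_delete_eq[OF D(1)] B by blast
  then have "A' \<subseteq> B" "A' \<inter> T = {}" using D(2) by auto
  then have "indep N A'" "A' \<inter> T = {}" using B(1) by (auto simp: indep_def)
  then show ?thesis
    using obtain_basis_delete[of N A' T] that N(1,2) unfolding is_matroid_def by blast
qed

text \<open>Here \<open>A = B - T\<close>. The rest of the ground set outside \<open>T\<close> is
  independent in the dual and extends to a basis \<open>D\<close> of the deleted dual; a larger
  \<open>D\<close> leaves a basis of \<open>M'\<close> inside \<open>A\<close>.\<close>

lemma quotient_basis_contains:
  assumes "A \<in> bases M"
  obtains A' where "A' \<in> bases M'" "A' \<subseteq> A"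
proof -
  obtain N T where N: "is_matroid N" "M = delete N T" "M' = contract N T"
    using quot unfolding quotient_le_def by blast
  obtain B where B: "B \<in> bases N" "A \<subseteq> B"
    using assms N(2) unfolding delete_def indep_def by auto
  then have A: "A = B - T" using bases_delete_eq assms N(2) by blast
  have "indep (dual N) (ground N - B - T)" "(ground N - B - T) \<inter> T = {}"
    using B(1) unfolding indep_def dual_def by auto
  moreover have "finite (ground (dual N))" "\<forall>B\<in>bases (dual N). B \<subseteq> ground (dual N)"
    using N(1) unfolding is_matroid_def dual_def by auto
  ultimately obtain D where D: "D \<in> bases (delete (dual N) T)" "ground N - B - T \<subseteq> D"
    using obtain_basis_delete by blast
  have "ground N - T - D \<in> bases M'"
    using D(1) N(3) unfolding contract_def by (auto simp: dual_def delete_def)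
  moreover have "ground N - T - D \<subseteq> A" using D(2) A by auto
  ultimately show ?thesis using that by blast
qed

end

text \<open>Inclusions between finite sets of equal size are equalities, so the two preceding lemmas
  make the families of bases agree.\<close>

lemma quotient_same_rank:
  assumes "quotient_le M' M" "M \<in> lpms n" "M' \<in> lpms n"
    and "A \<in> bases M" "A' \<in> bases M'" "card A = card A'"
  shows "M = M'"
proof (rule lpms_eqI[OF assms(2,3)])
  have card: "card X = card A \<and> finite X" if "X \<in> bases M" for X
    using that assms(2,4) finite_subset[of X "{1..n}"] unfolding lpms_def lpm_def by auto
  have card': "card X = card A' \<and> finite X" if "X \<in> bases M'" for X
    using that assms(3,5) finite_subset[of X "{1..n}"] unfolding lpms_def lpm_def by auto
  have "X \<in> bases M'" if X: "X \<in> bases M" for X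
    using quotient_basis_contains[OF assms(1) X] card[OF X] card' assms(6) card_subset_eq by metis
  moreover have "X \<in> bases M" if X: "X \<in> bases M'" for X
    using quotient_basis_extends[OF assms(1) X] card card'[OF X] assms(6) card_subset_eq by metis
  ultimately show "bases M = bases M'" by blast
qed

text \<open>The ranks differ by one, so a matroid in between has the rank of one end and therefore
  equals it.\<close>

lemma covered_by_if_quotient:
  assumes "path_pair n U L" "path_pair n U' L'" "card U = Suc (card U')"
    and quot: "quotient_le (lpm n U' L') (lpm n U L)"
  shows "covered_by n (lpm n U' L') (lpm n U L)"
proof -
  let ?M = "lpm n U L" and ?M' = "lpm n U' L'"
  have mem: "?M \<in> lpms n" "?M' \<in> lpms n" using assms(1,2) unfolding lpms_def by auto
  have bases: "U \<in> bases ?M" "U' \<in> bases ?M'" using assms upper_in_bases_lpm by auto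
  have "?M' \<noteq> ?M" using bases card_bases_lpm assms(3) by (metis n_not_Suc_n)
  moreover have "K = ?M' \<or> K = ?M"
    if K: "K \<in> lpms n" "quotient_le ?M' K" "quotient_le K ?M" for K
  proof -
    obtain X where X: "X \<in> bases K" using quotient_basis_extends[OF K(2) bases(2)] .
    have cardK: "card Y = card X \<and> finite Y" if "Y \<in> bases K" for Y
      using that X K(1) finite_subset[of Y "{1..n}"] unfolding lpms_def lpm_def by auto
    obtain Y where Y: "Y \<in> bases K" "U' \<subseteq> Y" using quotient_basis_extends[OF K(2) bases(2)] .
    obtain Z where Z: "Z \<in> bases ?M" "X \<subseteq> Z" using quotient_basis_extends[OF K(3) X] .
    have "card U' \<le> card X" using Y cardK card_mono by metis
    moreover have "card X \<le> card U"
      using Z card_bases_lpm[OF Z(1)] finite_subset[of Z "{1..n}"] card_mono[of Z X]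
      by (auto simp: lpm_def)
    ultimately consider "card X = card U'" | "card X = card U" using assms(3) by linarith
    then show ?thesis
      using quotient_same_rank[OF K(2,1) mem(2) X bases(2)]
        quotient_same_rank[OF K(3) mem(1) K(1) bases(1) X] by cases auto
  qed
  ultimately show ?thesis unfolding covered_by_def using mem quot by blast
qed

section \<open>Good pairs give quotients\<close>

text \<open>\<open>q\<close> is the last contact with the upper bound before \<open>x\<close>, and
  \<open>p\<close> the first contact with the lower bound from \<open>x\<close> on. Replacing
  \<open>x\<close> by some \<open>y \<notin> A\<close> stays in the strip exactly when
  \<open>q < y \<le> p\<close>: moving a North step left raises the heights in between, moving it
  right lowers them.\<close>

lemma critical_interval:
  assumes "A \<subseteq> {1..n}" "x \<in> A" "cnt A 0 = up 0" "cnt A n = lo n" "\<forall>m. lo m \<le> cnt A m \<and> cnt A m \<le> up m"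
  obtains q p where "q < x" "x \<le> p" "p \<le> n" "cnt A q = up q" "cnt A p = lo p"
    "\<And>m. q < m \<Longrightarrow> m < x \<Longrightarrow> cnt A m < up m" "\<And>m. x \<le> m \<Longrightarrow> m < p \<Longrightarrow> lo m < cnt A m"
proof -
  have x: "1 \<le> x" "x \<le> n" using assms(1,2) by auto
  let ?Q = "\<lambda>m. m < x \<and> cnt A m = up m" and ?P = "\<lambda>m. x \<le> m \<and> cnt A m = lo m"
  have Q0: "?Q 0" using x assms(3) by simp
  have Pn: "?P n" using x assms(4) by simp
  have "?Q (GREATEST m. ?Q m)" by (rule GreatestI_nat[of ?Q 0 x]) (use Q0 in auto)
  moreover have "?P (LEAST m. ?P m)" by (rule LeastI[of ?P n]) (use Pn in auto)
  moreover have "(LEAST m. ?P m) \<le> n" by (rule Least_le) (use Pn in auto)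
  moreover have "cnt A m < up m" if "(GREATEST m. ?Q m) < m" "m < x" for m
    using that Greatest_le_nat[of ?Q m x] assms(5) by (meson le_neq_implies_less less_imp_le not_le)
  moreover have "lo m < cnt A m" if "x \<le> m" "m < (LEAST m. ?P m)" for m
    using that not_less_Least[of m ?P] assms(5) by (metis le_neq_implies_less)
  ultimately show ?thesis using that by blast
qed

lemma cnt_exchange:
  assumes "x \<in> A" "y \<notin> A"
  shows "cnt (insert y (A - {x})) m + of_bool (x \<le> m) = cnt A m + of_bool (y \<le> m)"
  using assms cnt_remove[of x A m] cnt_insert[of y "A - {x}" m] by auto

text \<open>The premise \<open>bound\<close> asks that \<open>B\<close> climb at least as much as
  \<open>A\<close> between the two contacts. Any \<open>B\<close> in the same strip does; as a
  premise it also admits a \<open>B\<close> from a different strip.\<close>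

lemma strip_exchange:
  assumes A: "A \<in> strip n lo up" and x: "x \<in> A - B" and B: "B \<subseteq> {1..n}"
    and ends: "up 0 = 0" "lo n = card A"
    and bound: "\<And>q p. \<lbrakk>q < x; x \<le> p; cnt A q = up q; cnt A p = lo p;
      \<And>m. q < m \<Longrightarrow> m < x \<Longrightarrow> cnt A m < up m; \<And>m. x \<le> m \<Longrightarrow> m < p \<Longrightarrow> lo m < cnt A m\<rbrakk>
      \<Longrightarrow> lo p + cnt B q \<le> cnt B p + up q"
  shows "\<exists>y\<in>B - A. insert y (A - {x}) \<in> strip n lo up"
proof -
  have sub: "A \<subseteq> {1..n}" and btw: "\<forall>m. lo m \<le> cnt A m \<and> cnt A m \<le> up m"
    using A unfolding strip_def by auto
  have e: "cnt A 0 = up 0" "cnt A n = lo n" using cnt_0[OF sub] cnt_ge[OF sub order_refl] ends by auto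
  show ?thesis
  proof (rule critical_interval[OF sub _ e btw])
    show "x \<in> A" using x by blast
  next
    fix q p
    assume qp: "q < x" "x \<le> p" "cnt A q = up q" "cnt A p = lo p"
      and q: "\<And>m. q < m \<Longrightarrow> m < x \<Longrightarrow> cnt A m < up m"
      and p: "\<And>m. x \<le> m \<Longrightarrow> m < p \<Longrightarrow> lo m < cnt A m"
    have "cnt A p + cnt B q \<le> cnt B p + cnt A q" using bound[OF qp q p] qp by simp
    then obtain y where y: "y \<in> B - A" "q < y" "y \<le> p"
      using cnt_le_obtains[OF x qp(1,2)] by blast
    have "lo m \<le> cnt (insert y (A - {x})) m \<and> cnt (insert y (A - {x})) m \<le> up m" for m
      using cnt_exchange[of x A y m] x y btw[rule_format, of m] q[of m] p[of m]
      by (cases "x \<le> m"; cases "y \<le> m") auto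
    then have "insert y (A - {x}) \<in> strip n lo up"
      using sub B y unfolding strip_def by auto
    with y(1) show ?thesis by blast
  qed
qed

text \<open>
  Here \<open>U\<close> and \<open>L\<close> are the sets of the smaller matroid.  In the larger one the indices are
  \<open>i = cnt L l + 1\<close> and \<open>j = cnt U u + 1\<close>, so this says \<open>i \<le> j\<close> and \<open>u - l \<le> j - i\<close>
  without subtraction.
\<close>

definition good :: "nat set \<Rightarrow> nat set \<Rightarrow> nat \<Rightarrow> nat \<Rightarrow> bool" where
  "good U L u l \<longleftrightarrow> cnt L l \<le> cnt U u \<and> u + cnt L l \<le> l + cnt U u"

section \<open>Adding one label to a pair of boundary paths\<close>

locale path_extension =
  fixes n :: nat and U L :: "nat set" and u l :: nat
  assumes pair: "path_pair n U L"
    and u: "u \<in> {1..n} - U" and l: "l \<in> {1..n} - L"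
begin

lemma sub: "U \<subseteq> {1..n}" "L \<subseteq> {1..n}" and fin: "finite U" "finite L"
  and card_eq: "card U = card L" and cnt_LU: "cnt L m \<le> cnt U m"
  using pair finite_subset[of _ "{1..n}"] by (auto simp: path_pair_iff_cnt)

lemma cnt_U: "cnt (insert u U) m = cnt U m + of_bool (u \<le> m)"
  and cnt_L: "cnt (insert l L) m = cnt L m + of_bool (l \<le> m)"
  using u l by (simp_all add: cnt_insert)

text \<open>The new boundaries could cross only for \<open>l \<le> m < u\<close>, where the lower
  one is already raised and the upper one is not. Slopes are at most one, so the second inequality
  of \<open>good\<close> leaves a gap there.\<close>

lemma pair_insert:
  assumes "good U L u l"
  shows "path_pair n (insert u U) (insert l L)"
proof -
  have "cnt L m + of_bool (l \<le> m) \<le> cnt U m + of_bool (u \<le> m)" for m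
  proof (cases "l \<le> m \<and> m < u")
    case True
    have "cnt L m \<le> cnt L l + (m - l)" by (rule cnt_le_add) (use True in simp)
    moreover have "cnt U (u - 1) \<le> cnt U m + (u - 1 - m)" by (rule cnt_le_add) (use True in linarith)
    \<comment> \<open>As \<open>u \<notin> U\<close>, the path is flat at step \<open>u\<close>;
      this supplies the missing unit.\<close>
    moreover have "cnt U u = cnt U (u - 1)" using cnt_Suc[of U "u - 1"] u by auto
    moreover have "u + cnt L l \<le> l + cnt U u" using assms by (simp add: good_def)
    ultimately have "Suc (cnt L m) \<le> cnt U m" using True by linarith
    then show ?thesis using True by simp
  next
    case False
    then show ?thesis using cnt_LU[of m] by auto
  qed
  then show ?thesis
    using sub fin card_eq u l unfolding path_pair_iff_cnt by (auto simp: cnt_U cnt_L)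
qed

definition small where "small = strip n (cnt L) (cnt U)"
definition large where "large = strip n (cnt (insert l L)) (cnt (insert u U))"

lemma smallD:
  assumes "B \<in> small"
  shows "B \<subseteq> {1..n} \<and> finite B \<and> card B = card U \<and> cnt L m \<le> cnt B m \<and> cnt B m \<le> cnt U m"
proof -
  have "B \<in> bases (lpm n U L)" using assms bases_lpm[OF pair] small_def by simp
  then show ?thesis
    using assms card_bases_lpm finite_subset[of B "{1..n}"] unfolding small_def strip_def by blast
qed

end

section \<open>Exchange between the bases of the two matroids\<close>

locale good_extension = path_extension +
  assumes good: "good U L u l"
begin

lemma largeD:
  assumes "B \<in> large"
  shows "B \<subseteq> {1..n} \<and> finite B \<and> card B = Suc (card U) \<and>
    cnt L m + of_bool (l \<le> m) \<le> cnt B m \<and> cnt B m \<le> cnt U m + of_bool (u \<le> m)"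
proof -
  have "B \<in> bases (lpm n (insert u U) (insert l L))"
    using assms bases_lpm[OF pair_insert[OF good]] large_def by simp
  then have "card B = Suc (card U)" using card_bases_lpm u fin by fastforce
  then show ?thesis
    using assms finite_subset[of B "{1..n}"] unfolding large_def strip_def cnt_U cnt_L by blast
qed

text \<open>The heights form a chain
  \<open>cnt L p \<le> cnt L l \<le> cnt U u \<le> cnt U q\<close>.\<close>

lemma good_cross:
  assumes "u \<le> q" "q \<le> p" "p < l"
  shows "cnt L p \<le> cnt U q"
  using assms good cnt_mono[of p l L] cnt_mono[of u q U] unfolding good_def by linarith

text \<open>Adding \<open>y\<close> raises all heights from \<open>y\<close> on. It must therefore
  come after the last contact \<open>q\<close> with the larger upper boundary, and no later than the
  first violation \<open>p\<close> of the larger lower boundary. \<open>B\<close> obeys both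
  boundaries, so it climbs more than \<open>A\<close> from \<open>q\<close> to
  \<open>p\<close>.\<close>

lemma extend_small:
  assumes A: "A \<in> small" and B: "B \<in> large"
  shows "\<exists>y\<in>B - A. insert y A \<in> large"
proof -
  note AD = smallD[OF A] and BD = largeD[OF B]
  let ?P = "\<lambda>m. cnt A m < cnt L m + of_bool (l \<le> m)" and ?Q = "\<lambda>m. m \<le> n \<and> cnt A m = cnt U m + of_bool (u \<le> m)"
  define p where "p = (LEAST m. ?P m)"
  define q where "q = (GREATEST m. ?Q m)"
  have "?P n" using AD cnt_ge[of A n n] cnt_ge[of L n n] sub card_eq l by auto
  then have p: "?P p" unfolding p_def by (rule LeastI)
  have p_min: "cnt L m + of_bool (l \<le> m) \<le> cnt A m" if "m < p" for m
    using not_less_Least[of m ?P] that unfolding p_def by auto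
  have "?Q 0" using AD cnt_0[of A n] cnt_0[of U n] sub u by auto
  then have q: "?Q q" unfolding q_def by (rule GreatestI_nat[where b = n]) auto
  have q_max: "cnt A m < cnt U m + of_bool (u \<le> m)" if "q < m" for m
  proof (cases "m \<le> n")
    case True
    then have "\<not> ?Q m" using Greatest_le_nat[of ?Q m n] that unfolding q_def by auto
    then show ?thesis using True AD[of m] by auto
  next
    case False
    then show ?thesis using AD cnt_ge[of A n m] cnt_ge[of U n m] sub u by auto
  qed
  have pl: "l \<le> p" "cnt A p = cnt L p" and qu: "q < u" "cnt A q = cnt U q"
    using p q AD[of p] AD[of q] by (cases "l \<le> p"; cases "u \<le> q"; simp)+
  have "q < p"
  proof (rule ccontr)
    \<comment> \<open>Then \<open>l \<le> p \<le> q < u\<close>, and \<open>A\<close> gets from the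
      lower boundary at \<open>p\<close> to the upper one at \<open>q\<close> with slope at most
      one. The second inequality of \<open>good\<close> makes the upper boundary too high for
      that.\<close>
    assume "\<not> q < p"
    then have pq: "p \<le> q" by simp
    have "cnt U u = cnt U (u - 1)" using cnt_Suc[of U "u - 1"] u by auto
    moreover have "cnt L l = cnt L (l - 1)" using cnt_Suc[of L "l - 1"] l by auto
    moreover have "cnt L p \<le> cnt L l + (p - l)" using cnt_le_add pl(1) by blast
    moreover have "cnt A q \<le> cnt A p + (q - p)" using cnt_le_add pq by blast
    moreover have "cnt U (u - 1) \<le> cnt U q + (u - 1 - q)" using cnt_le_add[of q "u - 1" U] qu(1) by auto
    ultimately show False using good pl qu pq unfolding good_def by linarith
  qed
  moreover have "cnt A p + cnt B q < cnt B p + cnt A q"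
    using BD[of p] BD[of q] pl qu by auto
  ultimately obtain y where y: "y \<in> B - A" "q < y" "y \<le> p"
    using cnt_less_obtains[of q p A B] by auto
  have "cnt L m + of_bool (l \<le> m) \<le> cnt (insert y A) m \<and> cnt (insert y A) m \<le> cnt U m + of_bool (u \<le> m)" for m
    using cnt_insert[of y A m] y p_min[of m] q_max[of m] AD[of m] by (cases "y \<le> m") auto
  moreover have "insert y A \<subseteq> {1..n}" using y AD BD by blast
  ultimately have "insert y A \<in> large" unfolding large_def strip_def cnt_U cnt_L by blast
  then show ?thesis using y by blast
qed

text \<open>A \<open>B\<close> from the larger family can climb too little only if
  \<open>u \<le> q\<close> and \<open>p < l\<close>. There \<open>good_cross\<close> says that
  \<open>A\<close> gains no height, yet \<open>A\<close> takes the North step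
  \<open>x\<close>.\<close>

lemma exchange_small:
  assumes A: "A \<in> small" and B: "B \<in> small \<union> large" and x: "x \<in> A - B"
  shows "\<exists>y\<in>B - A. insert y (A - {x}) \<in> small"
  unfolding small_def
proof (rule strip_exchange[OF _ x])
  show "A \<in> strip n (cnt L) (cnt U)" using A small_def by simp
  show "B \<subseteq> {1..n}" using B smallD largeD by blast
  show "cnt U 0 = 0" using cnt_0 sub by blast
  show "cnt L n = card A" using cnt_ge[of L n n] sub card_eq smallD[OF A] by auto
next
  fix q p assume qp: "q < x" "x \<le> p" "cnt A q = cnt U q" "cnt A p = cnt L p"
  have "cnt A q < cnt A p"
    using x qp cnt_remove[of x A q] cnt_remove[of x A p] cnt_mono[of q p "A - {x}"] by auto
  then have "\<not> (u \<le> q \<and> p < l)" using good_cross[of q p] qp by auto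
  then have "\<not> u \<le> q \<or> l \<le> p" by auto
  then show "cnt L p + cnt B q \<le> cnt B p + cnt U q"
    using B smallD[of B q] smallD[of B p] largeD[of B q] largeD[of B p]
    by (cases "u \<le> q"; cases "l \<le> p") auto
qed

lemma exchange_large:
  assumes A: "A \<in> large" and B: "B \<in> large" and x: "x \<in> A - B"
  shows "\<exists>y\<in>B - A. insert y (A - {x}) \<in> large"
  unfolding large_def
proof (rule strip_exchange[OF _ x])
  show "A \<in> strip n (cnt (insert l L)) (cnt (insert u U))" using A large_def by simp
  show "B \<subseteq> {1..n}" using B largeD by blast
  show "cnt (insert u U) 0 = 0" using cnt_0[of U n] sub u by (auto simp: cnt_U)
  show "cnt (insert l L) n = card A" using cnt_ge[of L n n] sub card_eq largeD[OF A] l by (auto simp: cnt_L)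
next
  fix q p
  show "cnt (insert l L) p + cnt B q \<le> cnt B p + cnt (insert u U) q"
    using largeD[OF B, of q] largeD[OF B, of p] by (auto simp: cnt_U cnt_L)
qed

text \<open>If no exchange works, \<open>B\<close> climbs too little between two contacts of
  \<open>A\<close>; comparing the bounds of both strips then forces \<open>q < u\<close> and
  \<open>l \<le> p\<close>, and dropping \<open>x\<close> suffices.\<close>

lemma exchange_large_small:
  assumes A: "A \<in> large" and B: "B \<in> small" and x: "x \<in> A - B"
  shows "A - {x} \<in> small \<or> (\<exists>y\<in>B - A. insert y (A - {x}) \<in> large)"
proof (rule disjCI)
  assume no: "\<not> (\<exists>y\<in>B - A. insert y (A - {x}) \<in> large)"
  note AD = largeD[OF A] and BD = smallD[OF B]
  have "\<exists>q p. q < x \<and> x \<le> p \<and> cnt A q = cnt (insert u U) q \<and> cnt A p = cnt (insert l L) p \<and>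
    (\<forall>m. q < m \<longrightarrow> m < x \<longrightarrow> cnt A m < cnt (insert u U) m) \<and>
    (\<forall>m. x \<le> m \<longrightarrow> m < p \<longrightarrow> cnt (insert l L) m < cnt A m) \<and>
    \<not> cnt (insert l L) p + cnt B q \<le> cnt B p + cnt (insert u U) q"
  proof (rule ccontr)
    assume *: "\<not> ?thesis"
    have "\<exists>y\<in>B - A. insert y (A - {x}) \<in> strip n (cnt (insert l L)) (cnt (insert u U))"
    proof (rule strip_exchange[OF _ x])
      show "A \<in> strip n (cnt (insert l L)) (cnt (insert u U))" using A large_def by simp
      show "B \<subseteq> {1..n}" using BD by blast
      show "cnt (insert u U) 0 = 0" using cnt_0[of U n] sub u by (auto simp: cnt_U)
      show "cnt (insert l L) n = card A" using cnt_ge[of L n n] sub card_eq AD l by (auto simp: cnt_L)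
    qed (use * in blast)
    then show False using no large_def by simp
  qed
  then obtain q p where qp: "q < x" "x \<le> p"
    and q: "\<And>m. q < m \<Longrightarrow> m < x \<Longrightarrow> cnt A m < cnt U m + of_bool (u \<le> m)"
    and p: "\<And>m. x \<le> m \<Longrightarrow> m < p \<Longrightarrow> cnt L m + of_bool (l \<le> m) < cnt A m"
    and bad: "cnt B p + cnt U q + of_bool (u \<le> q) < cnt L p + of_bool (l \<le> p) + cnt B q"
    unfolding cnt_U cnt_L by (auto simp: not_le)
  have *: "l \<le> p" "q < u" using bad BD[of p] BD[of q]
    by (cases "l \<le> p"; cases "u \<le> q"; simp)+
  \<comment> \<open>Up to \<open>q\<close> both upper bounds agree, and between \<open>q\<close> and
    \<open>x\<close> the path \<open>A\<close> stays strictly below the larger one. From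
    \<open>x\<close> to \<open>p\<close> it stays strictly above the lower bound, and from
    \<open>p\<close> on the larger lower bound has its extra unit.\<close>
  have "cnt L m \<le> cnt (A - {x}) m \<and> cnt (A - {x}) m \<le> cnt U m" for m
  proof (cases "x \<le> m")
    case True
    then have "cnt A m = Suc (cnt (A - {x}) m)" using cnt_remove[of x A m] x by simp
    moreover have "cnt L m < cnt A m" using p[OF True] AD[of m] *(1) by (cases "m < p") auto
    moreover have "cnt A m \<le> cnt U m + of_bool (u \<le> m)" using AD by blast
    ultimately show ?thesis by (cases "u \<le> m") simp_all
  next
    case False
    then have "cnt A m = cnt (A - {x}) m" using cnt_remove[of x A m] x by simp
    moreover have "cnt A m \<le> cnt U m" using q[of m] AD[of m] *(2) False by (cases "q < m"; cases "u \<le> m") auto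
    moreover have "cnt L m \<le> cnt A m" using AD[of m] by simp
    ultimately show ?thesis by simp
  qed
  then show "A - {x} \<in> small" using AD unfolding small_def strip_def by auto
qed

text \<open>Take a smaller basis with the fewest elements outside \<open>A\<close>; an exchange
  towards \<open>A\<close> would remove one more.\<close>

lemma contain_small:
  assumes A: "A \<in> large"
  obtains B where "B \<in> small" "B \<subseteq> A"
proof -
  have "U \<in> small" using upper_in_bases_lpm[OF pair] bases_lpm[OF pair] small_def by simp
  define B where "B = arg_min (\<lambda>B. card (B - A)) (\<lambda>B. B \<in> small)"
  have B: "B \<in> small" unfolding B_def using \<open>U \<in> small\<close> by (rule arg_min_natI)
  have min: "card (B - A) \<le> card (C - A)" if "C \<in> small" for C
    unfolding B_def using that by (rule arg_min_nat_le)
  have "B \<subseteq> A"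
  proof (rule ccontr)
    assume "\<not> B \<subseteq> A"
    then obtain x where x: "x \<in> B - A" by blast
    then obtain y where y: "y \<in> A - B" "insert y (B - {x}) \<in> small"
      using exchange_small[OF B] A by blast
    have "insert y (B - {x}) - A = (B - A) - {x}" using y by auto
    moreover have "card ((B - A) - {x}) < card (B - A)"
      using x smallD[OF B] by (intro card_Diff1_less) auto
    ultimately show False using min[OF y(2)] by simp
  qed
  with B show ?thesis using that by blast
qed

text \<open>The exchange lemmas are the cases of basis exchange in \<open>N\<close>. By
  \<open>extend_small\<close>, bases containing \<open>0\<close> add nothing to the deletion; by
  \<open>contain_small\<close>, bases avoiding \<open>0\<close> add nothing to the
  contraction.\<close>

lemma quotient_lpm: "quotient_le (lpm n U L) (lpm n (insert u U) (insert l L))"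
proof -
  let ?E = "{1..n}" and ?T = "{0::nat}"
  have small: "bases (lpm n U L) = small" using bases_lpm[OF pair] small_def by simp
  have large: "bases (lpm n (insert u U) (insert l L)) = large"
    using bases_lpm[OF pair_insert[OF good]] large_def by simp
  have ex: "U \<in> small" "insert u U \<in> large"
    using upper_in_bases_lpm[OF pair] upper_in_bases_lpm[OF pair_insert[OF good]] small large by auto
  \<comment> \<open>The elementary extension, with \<open>0\<close>, which lies outside the ground set, as the new element.\<close>
  define N where "N = Basis_System (insert 0 ?E) (large \<union> insert 0 ` small)"
  have no0: "0 \<notin> B" if "B \<in> small \<union> large" for B using that smallD largeD by fastforce
  have subE: "B \<subseteq> ?E" if "B \<in> small \<union> large" for B using that smallD largeD by fastforce
  have "is_matroid N"
    unfolding is_matroid_def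
  proof (intro conjI ballI)
    show "finite (ground N)" "bases N \<noteq> {}" using ex unfolding N_def by auto
    show "B \<subseteq> ground N" if "B \<in> bases N" for B using that subE unfolding N_def by auto
  next
    fix A B x
    assume AB: "A \<in> bases N" "B \<in> bases N" and x: "x \<in> A - B"
    from AB consider
        (ll) "A \<in> large" "B \<in> large"
      | (ls) B' where "A \<in> large" "B' \<in> small" "B = insert 0 B'"
      | (sl) A' where "A' \<in> small" "A = insert 0 A'" "B \<in> large"
      | (ss) A' B' where "A' \<in> small" "A = insert 0 A'" "B' \<in> small" "B = insert 0 B'"
      unfolding N_def by auto
    then show "\<exists>y\<in>B - A. insert y (A - {x}) \<in> bases N"
    proof cases
      case ll
      then show ?thesis using exchange_large[OF ll x] unfolding N_def by auto
    next
      case ls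
      then have "0 \<notin> A" using no0 by blast
      \<comment> \<open>The alternative \<open>A - {x} \<in> small\<close> is the exchange of
        \<open>x\<close> for \<open>0\<close>.\<close>
      then show ?thesis using ls exchange_large_small[OF ls(1,2), of x] x unfolding N_def by auto
    next
      case sl
      show ?thesis
      proof (cases "x = 0")
        case True
        then have "A - {x} = A'" using sl no0 by auto
        then show ?thesis using extend_small[OF sl(1,3)] True sl no0[of B] unfolding N_def by fastforce
      next
        case False
        then have "x \<in> A' - B" using sl(2) x by blast
        from exchange_small[OF sl(1) UnI2[OF sl(3)] this]
        obtain y where y: "y \<in> B - A'" "insert y (A' - {x}) \<in> small" by blast
        have "y \<noteq> 0" using no0[OF UnI2[OF sl(3)]] y(1) by (metis DiffD1)
        moreover have "insert y (A - {x}) = insert 0 (insert y (A' - {x}))" using False sl by auto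
        ultimately show ?thesis using y sl unfolding N_def by auto
      qed
    next
      case ss
      then have "x \<noteq> 0" using x by auto
      then have "x \<in> A' - B'" using ss(2,4) x by blast
      from exchange_small[OF ss(1) UnI1[OF ss(3)] this]
      obtain y where y: "y \<in> B' - A'" "insert y (A' - {x}) \<in> small" by blast
      have "y \<noteq> 0" using no0[OF UnI1[OF ss(3)]] y(1) by (metis DiffD1)
      moreover have "insert y (A - {x}) = insert 0 (insert y (A' - {x}))" using \<open>x \<noteq> 0\<close> ss by auto
      ultimately show ?thesis using y ss unfolding N_def by auto
    qed
  qed
  moreover have "lpm n (insert u U) (insert l L) = delete N ?T"
  proof -
    have ind: "indep N I \<and> I \<inter> ?T = {} \<longleftrightarrow> (\<exists>B\<in>large. I \<subseteq> B)" for I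
    proof
      assume I: "indep N I \<and> I \<inter> ?T = {}"
      then consider B where "B \<in> large" "I \<subseteq> B" | B where "B \<in> small" "I \<subseteq> B"
        unfolding indep_def N_def by auto
      then show "\<exists>B\<in>large. I \<subseteq> B"
      proof cases
        case 1
        then show ?thesis by blast
      next
        case 2
        from extend_small[OF 2(1) ex(2)] obtain y where "insert y B \<in> large" by blast
        then show ?thesis using 2(2) by blast
      qed
    next
      assume "\<exists>B\<in>large. I \<subseteq> B"
      then show "indep N I \<and> I \<inter> ?T = {}" using no0 unfolding indep_def N_def by auto
    qed
    have eq: "B = C" if "B \<in> large" "C \<in> large" "B \<subseteq> C" for B C
      using that largeD card_subset_eq by metis
    have "bases (delete N ?T) = {I. (\<exists>B\<in>large. I \<subseteq> B) \<and> (\<forall>J. (\<exists>B\<in>large. J \<subseteq> B) \<and> I \<subseteq> J \<longrightarrow> J = I)}"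
      unfolding delete_def using ind by (simp flip: conj_assoc)
    also have "\<dots> = large" using eq by blast
    finally show ?thesis using large by (intro basis_system.expand) (auto simp: delete_def N_def)
  qed
  moreover have "lpm n U L = contract N ?T"
  proof -
    let ?D = "dual N"
    have ind: "indep ?D I \<and> I \<inter> ?T = {} \<longleftrightarrow> (\<exists>B\<in>small. I \<subseteq> ?E - B)" for I
    proof
      assume I: "indep ?D I \<and> I \<inter> ?T = {}"
      then obtain B where B: "B \<in> bases N" "I \<subseteq> ?E - B" unfolding indep_def dual_def N_def by auto
      then consider "B \<in> large" | B' where "B' \<in> small" "B = insert 0 B'" unfolding N_def by auto
      then show "\<exists>B\<in>small. I \<subseteq> ?E - B"
      proof cases
        case 1
        obtain C where "C \<in> small" "C \<subseteq> B" using contain_small[OF 1] .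
        then show ?thesis using B(2) by blast
      next
        case 2
        then have "I \<subseteq> ?E - B'" using B(2) by auto
        with 2(1) show ?thesis by (rule bexI[rotated])
      qed
    next
      assume "\<exists>B\<in>small. I \<subseteq> ?E - B"
      then obtain B where B: "B \<in> small" "I \<subseteq> ?E - B" by blast
      have "insert 0 B \<in> bases N" using B(1) by (simp add: N_def)
      then have "ground N - insert 0 B \<in> bases ?D" by (simp add: dual_def)
      moreover have "I \<subseteq> ground N - insert 0 B" using B(2) by (auto simp: N_def)
      ultimately have "indep ?D I" unfolding indep_def by (rule bexI[rotated])
      moreover have "I \<inter> ?T = {}" using B(2) by auto
      ultimately show "indep ?D I \<and> I \<inter> ?T = {}" ..
    qed
    have eq: "B = C" if "B \<in> small" "C \<in> small" "?E - B \<subseteq> ?E - C" for B C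
    proof -
      have "C \<subseteq> B" using that smallD by blast
      then show ?thesis using that smallD card_subset_eq by metis
    qed
    have "bases (delete ?D ?T) = {I. (\<exists>B\<in>small. I \<subseteq> ?E - B) \<and> (\<forall>J. (\<exists>B\<in>small. J \<subseteq> ?E - B) \<and> I \<subseteq> J \<longrightarrow> J = I)}"
      unfolding delete_def using ind by (simp flip: conj_assoc)
    also have "\<dots> = (\<lambda>B. ?E - B) ` small" (is "?l = ?r")
    proof (intro equalityI subsetI)
      fix I assume "I \<in> ?l"
      then show "I \<in> ?r" by blast
    next
      fix I assume "I \<in> ?r"
      then obtain B where B: "B \<in> small" "I = ?E - B" by blast
      have "J = I" if J: "C \<in> small" "J \<subseteq> ?E - C" "I \<subseteq> J" for J C
        using eq[OF B(1) J(1)] J B by blast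
      then show "I \<in> ?l" using B by blast
    qed
    finally have "bases (delete ?D ?T) = (\<lambda>B. ?E - B) ` small" .
    moreover have "?E - (?E - B) = B" if "B \<in> small" for B using smallD that by blast
    moreover have "ground (delete ?D ?T) = ?E" by (auto simp: delete_def dual_def N_def)
    ultimately have "bases (contract N ?T) = small"
      unfolding contract_def dual_def[of "delete ?D ?T"] by (auto simp: image_image)
    then show ?thesis using small \<open>ground (delete ?D ?T) = ?E\<close>
      by (intro basis_system.expand) (auto simp: contract_def dual_def[of "delete ?D ?T"])
  qed
  moreover have "finite ?T" "ground (lpm n (insert u U) (insert l L)) \<inter> ?T = {}"
    "ground N = ground (lpm n (insert u U) (insert l L)) \<union> ?T"
    by (auto simp: N_def)
  ultimately show ?thesis
    unfolding quotient_le_def by (intro exI[of _ N] exI[of _ ?T] conjI)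
qed

lemma covered: "covered_by n (lpm n U L) (lpm n (insert u U) (insert l L))"
  using covered_by_if_quotient[OF pair_insert[OF good] pair _ quotient_lpm] fin u by simp

end

section \<open>Quotients give good pairs\<close>

text \<open>Lets a path be prescribed by its heights: its North steps are the places where
  \<open>h\<close> rises.\<close>

lemma obtain_cnt_eq:
  fixes h :: "nat \<Rightarrow> nat"
  assumes "h 0 = 0" "\<And>m. h (Suc m) = h m \<or> h (Suc m) = Suc (h m)" "\<And>m. n \<le> m \<Longrightarrow> h m = h n"
  obtains B where "B \<subseteq> {1..n}" "\<And>m. cnt B m = h m"
proof
  let ?B = "{x. 0 < x \<and> h (x - 1) < h x}"
  show "?B \<subseteq> {1..n}"
  proof
    fix x assume "x \<in> ?B"
    then have "0 < x" "h (x - 1) \<noteq> h x" by auto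
    moreover have "h (x - 1) = h x" if "n < x" using assms(3)[of x] assms(3)[of "x - 1"] that by simp
    ultimately show "x \<in> {1..n}" by (cases "n < x") auto
  qed
  show "cnt ?B m = h m" for m
  proof (induction m)
    case 0
    then show ?case using assms(1) by (simp add: cnt_def)
  next
    case (Suc m)
    then show ?case using assms(2)[of m] by (auto simp: cnt_Suc)
  qed
qed

context path_extension
begin

lemma good_if_quotient:
  assumes pair': "path_pair n (insert u U) (insert l L)"
    and quot: "quotient_le (lpm n U L) (lpm n (insert u U) (insert l L))"
  shows "good U L u l"
proof -
  have le: "cnt L m + of_bool (l \<le> m) \<le> cnt U m + of_bool (u \<le> m)" for m
    using pair' by (auto simp: path_pair_iff_cnt cnt_U cnt_L)
  have bases: "bases (lpm n U L) = small" "bases (lpm n (insert u U) (insert l L)) = large"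
    using bases_lpm[OF pair] bases_lpm[OF pair'] small_def large_def by auto
  have step: "cnt L (Suc m) = cnt L m \<or> cnt L (Suc m) = Suc (cnt L m)"
    "cnt U (Suc m) = cnt U m \<or> cnt U (Suc m) = Suc (cnt U m)"
    "cnt (insert l L) (Suc m) = cnt (insert l L) m \<or> cnt (insert l L) (Suc m) = Suc (cnt (insert l L) m)"
    "cnt (insert u U) (Suc m) = cnt (insert u U) m \<or> cnt (insert u U) (Suc m) = Suc (cnt (insert u U) m)" for m
    by (simp_all add: cnt_Suc)
  have sub': "insert u U \<subseteq> {1..n}" "insert l L \<subseteq> {1..n}"
    using pair' unfolding path_pair_iff_cnt by auto
  have U_u: "cnt U u = cnt U (u - 1)" and L_l: "cnt L l = cnt L (l - 1)"
    using cnt_Suc[of U "u - 1"] cnt_Suc[of L "l - 1"] u l by auto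
  have add1: "card B = Suc (card A) \<and> finite B \<and> finite A" if "A \<in> small" "B \<in> large" for A B
    using that bases card_bases_lpm[of A n U L] card_bases_lpm[of B n "insert u U" "insert l L"] u fin
      finite_subset[of _ "{1..n}"] by (auto simp: small_def large_def strip_def)
  have remove: "\<exists>x. x \<in> B \<and> A = B - {x}" if "A \<in> small" "B \<in> large" "A \<subseteq> B" for A B
  proof -
    have "card (B - A) = 1" using add1[OF that(1,2)] that(3) by (simp add: card_Diff_subset)
    then obtain x where "B - A = {x}" by (auto simp: card_1_singleton_iff)
    then show ?thesis using that(3) by blast
  qed
  have "cnt L l \<le> cnt U u"
  proof (rule ccontr)
    assume bad: "\<not> cnt L l \<le> cnt U u"
    have ul: "u < l" using cnt_LU[of l] cnt_mono[of l u U] bad by (meson le_trans not_le)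
    \<comment> \<open>The height of the larger upper boundary at \<open>u\<close>. By
      \<open>bad\<close> the lower boundary has reached it before \<open>l\<close>, so a path can
      wait at height \<open>c\<close> in between.\<close>
    define c where "c = Suc (cnt U u)"
    \<comment> \<open>A basis of the larger matroid that follows the upper boundary up to \<open>u\<close> and the lower one from
      before \<open>l\<close>: deleting an element \<open>x\<close> requires both \<open>x \<le> u\<close> and \<open>l \<le> x\<close>.\<close>
    define h where "h m = min (cnt (insert u U) m) (max c (cnt (insert l L) m))" for m
    have "h 0 = 0" using cnt_0[OF sub'(1)] by (simp add: h_def)
    moreover have "h (Suc m) = h m \<or> h (Suc m) = Suc (h m)" for m
      using step(3,4)[of m] unfolding h_def by linarith
    moreover have "h m = h n" if "n \<le> m" for m
      using that cnt_ge[OF sub'(1)] cnt_ge[OF sub'(2)] unfolding h_def by simp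
    ultimately obtain B where B: "B \<subseteq> {1..n}" "\<And>m. cnt B m = h m"
      using obtain_cnt_eq[of h n] by blast
    have "B \<in> large" unfolding large_def strip_def
      using B le by (auto simp: h_def cnt_U cnt_L)
    then obtain A where A: "A \<in> small" "A \<subseteq> B" using quotient_basis_contains[OF quot] bases by metis
    then obtain x where x: "x \<in> B" "A = B - {x}" using remove \<open>B \<in> large\<close> by blast
    have "cnt B u = Suc (cnt U u)" unfolding B(2) h_def c_def cnt_U by simp
    moreover have "cnt A u \<le> cnt U u" using A by (simp add: small_def strip_def)
    ultimately have "x \<le> u" using cnt_remove[OF x(1), of u] x(2) by (cases "x \<le> u") auto
    have "\<not> l \<le> l - 1" using ul by linarith
    then have "cnt B (l - 1) \<le> cnt L (l - 1)"
      unfolding B(2) h_def c_def using bad L_l ul by (simp add: cnt_L)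
    moreover have "cnt L (l - 1) \<le> cnt A (l - 1)" using A by (simp add: small_def strip_def)
    moreover have "x \<le> l - 1" using \<open>x \<le> u\<close> ul by linarith
    ultimately show False using cnt_remove[OF x(1), of "l - 1"] x(2) by auto
  qed
  moreover have "u + cnt L l \<le> l + cnt U u"
  proof (rule ccontr)
    assume bad: "\<not> u + cnt L l \<le> l + cnt U u"
    have lu: "l < u"
    proof (rule ccontr)
      assume "\<not> l < u"
      then show False using bad cnt_LU[of l] cnt_le_add[of u l U] by linarith
    qed
    \<comment> \<open>The line of slope one through the point of the lower boundary at
      \<open>l\<close>, cut off at 0 by natural subtraction; it starts at 0 because
      \<open>cnt L l \<le> l\<close>. By \<open>bad\<close> it is no lower than the upper boundary
      at \<open>u - 1\<close>.\<close>
    define d where "d m = cnt L l + m - l" for m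
    have d_Suc: "d (Suc m) = d m \<or> d (Suc m) = Suc (d m)" for m unfolding d_def by arith
    \<comment> \<open>A basis of the smaller matroid that follows the lower boundary up to \<open>l\<close> and the upper one from
      before \<open>u\<close>: inserting an element \<open>y\<close> requires both \<open>y \<le> l\<close> and \<open>u \<le> y\<close>.\<close>
    define h where "h m = max (cnt L m) (min (cnt U m) (d m))" for m
    have "cnt L l \<le> cnt L 0 + (l - 0)" by (rule cnt_le_add) simp
    then have "h 0 = 0" using cnt_0[OF sub(1)] cnt_0[OF sub(2)] by (simp add: h_def d_def)
    moreover have "h (Suc m) = h m \<or> h (Suc m) = Suc (h m)" for m
      using step(1,2)[of m] d_Suc[of m] unfolding h_def by linarith
    moreover have "h m = h n" if "n \<le> m" for m
      using that cnt_ge[OF sub(1)] cnt_ge[OF sub(2)] card_eq unfolding h_def by simp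
    ultimately obtain A where A: "A \<subseteq> {1..n}" "\<And>m. cnt A m = h m"
      using obtain_cnt_eq[of h n] by blast
    have "A \<in> small" unfolding small_def strip_def
      using A cnt_LU by (auto simp: h_def)
    then obtain B where B: "B \<in> large" "A \<subseteq> B" using quotient_basis_extends[OF quot] bases by metis
    then obtain y where y: "y \<in> B" "A = B - {y}" using remove \<open>A \<in> small\<close> by blast
    have "cnt A l = cnt L l" unfolding A(2) h_def d_def by simp
    moreover have "Suc (cnt L l) \<le> cnt B l"
      using B by (auto simp: large_def strip_def cnt_L dest: spec[of _ l])
    ultimately have "y \<le> l" using cnt_remove[OF y(1), of l] y(2) by (cases "y \<le> l") auto
    have "cnt U (u - 1) \<le> d (u - 1)" unfolding d_def using bad lu U_u by linarith
    then have "cnt U (u - 1) \<le> cnt A (u - 1)" unfolding A(2) h_def by simp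
    moreover have "cnt B (u - 1) \<le> cnt U (u - 1)"
    proof -
      have "\<not> u \<le> u - 1" using lu by linarith
      moreover have "cnt B (u - 1) \<le> cnt (insert u U) (u - 1)"
        using B(1) by (simp add: large_def strip_def)
      ultimately show ?thesis by (simp add: cnt_U)
    qed
    moreover have "y \<le> u - 1" using \<open>y \<le> l\<close> lu by linarith
    ultimately show False using cnt_remove[OF y(1), of "u - 1"] y(2) by auto
  qed
  ultimately show ?thesis by (simp add: good_def)
qed

end

section \<open>Label sequences of maximal chains\<close>

text \<open>The images of \<open>{1..<i}\<close> are the boundary sets below the \<open>i\<close>-th
  cover, which is the side that \<open>good\<close> refers to.\<close>

definition good_steps :: "nat \<Rightarrow> (nat \<Rightarrow> nat) \<Rightarrow> (nat \<Rightarrow> nat) \<Rightarrow> bool" where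
  "good_steps n \<sigma> \<tau> \<longleftrightarrow> (\<forall>i\<in>{1..n}. good (\<tau> ` {1..<i}) (\<sigma> ` {1..<i}) (\<tau> i) (\<sigma> i))"

lemma path_extension_image:
  assumes "\<sigma> permutes {1..n}" "\<tau> permutes {1..n}" "i \<in> {1..n}"
    and "path_pair n (\<tau> ` {1..<i}) (\<sigma> ` {1..<i})"
  shows "path_extension n (\<tau> ` {1..<i}) (\<sigma> ` {1..<i}) (\<tau> i) (\<sigma> i)"
proof
  have "\<pi> i \<in> {1..n} - \<pi> ` {1..<i}" if "\<pi> permutes {1..n}" for \<pi>
  proof
    show "\<pi> i \<in> {1..n}" using permutes_in_image[OF that, of i] assms(3) by simp
    show "\<pi> i \<notin> \<pi> ` {1..<i}" using inj_image_mem_iff[OF permutes_inj[OF that], of i] by simp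
  qed
  then show "\<tau> i \<in> {1..n} - \<tau> ` {1..<i}" "\<sigma> i \<in> {1..n} - \<sigma> ` {1..<i}" using assms(1,2) by blast+
qed (fact assms(4))

lemma image_atLeastLessThan_Suc_insert:
  "(1::nat) \<le> i \<Longrightarrow> f ` {1..<Suc i} = insert (f i) (f ` {1..<i})"
  by (auto simp: less_Suc_eq)

lemma nth_perm_pair_seq: "i \<in> {1..n} \<Longrightarrow> perm_pair_seq n \<sigma> \<tau> ! (i - 1) = (\<sigma> i, \<tau> i)"
  unfolding perm_pair_seq_def by (auto simp del: upt_Suc)

lemma cover_labelI:
  assumes "covered_by n (lpm n (U - {u}) (L - {l})) (lpm n U L)"
    and "path_pair n U L" "path_pair n (U - {u}) (L - {l})" "u \<in> U" "l \<in> L"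
  shows "cover_label n (lpm n (U - {u}) (L - {l})) (lpm n U L) (l, u)"
  using assms unfolding cover_label_def by blast

text \<open>A cover label only asserts some pair of boundary sets. Going up the chain,
  \<open>lpm_inject\<close> identifies that pair with the sets of labels used so far.\<close>

lemma ex_maximal_chain_iff_good_steps:
  assumes \<sigma>: "\<sigma> permutes {1..n}" and \<tau>: "\<tau> permutes {1..n}"
  shows "(\<exists>M. maximal_chain n M \<and> label_sequence n M (perm_pair_seq n \<sigma> \<tau>)) \<longleftrightarrow> good_steps n \<sigma> \<tau>"
proof
  assume "\<exists>M. maximal_chain n M \<and> label_sequence n M (perm_pair_seq n \<sigma> \<tau>)"
  then obtain M where M: "maximal_chain n M" "label_sequence n M (perm_pair_seq n \<sigma> \<tau>)" by blast
  have M0: "M 0 = lpm n {} {}" using M(1) by (simp add: maximal_chain_def)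
  have lab: "cover_label n (M (i - 1)) (M i) (\<sigma> i, \<tau> i)" if "i \<in> {1..n}" for i
    using M(2) that nth_perm_pair_seq[OF that, of \<sigma> \<tau>] unfolding label_sequence_def by metis
  let ?U = "\<lambda>i. \<tau> ` {1..<Suc i}" and ?L = "\<lambda>i. \<sigma> ` {1..<Suc i}"
  have step: "path_pair n (?U i) (?L i) \<and> M i = lpm n (?U i) (?L i) \<and>
      good (\<tau> ` {1..<i}) (\<sigma> ` {1..<i}) (\<tau> i) (\<sigma> i)"
    if i: "i \<in> {1..n}" and IH: "path_pair n (\<tau> ` {1..<i}) (\<sigma> ` {1..<i})"
      "M (i - 1) = lpm n (\<tau> ` {1..<i}) (\<sigma> ` {1..<i})" for i
  proof -
    obtain U L where UL: "path_pair n U L" "M i = lpm n U L" "\<tau> i \<in> U" "\<sigma> i \<in> L"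
      "path_pair n (U - {\<tau> i}) (L - {\<sigma> i})" "M (i - 1) = lpm n (U - {\<tau> i}) (L - {\<sigma> i})"
      and cov: "covered_by n (M (i - 1)) (M i)"
      using lab[OF i] unfolding cover_label_def by blast
    have "U - {\<tau> i} = \<tau> ` {1..<i}" "L - {\<sigma> i} = \<sigma> ` {1..<i}"
      using lpm_inject[OF UL(5) IH(1)] UL(6) IH(2) by simp_all
    then have eq: "U = insert (\<tau> i) (\<tau> ` {1..<i})" "L = insert (\<sigma> i) (\<sigma> ` {1..<i})"
      using UL(3,4) by blast+
    have "quotient_le (M (i - 1)) (M i)" using cov unfolding covered_by_def by blast
    then have "good (\<tau> ` {1..<i}) (\<sigma> ` {1..<i}) (\<tau> i) (\<sigma> i)"
      using path_extension.good_if_quotient[OF path_extension_image[OF \<sigma> \<tau> i IH(1)]]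
        UL(1,2) IH(2) unfolding eq by simp
    then show ?thesis
      using UL(1,2) i eq image_atLeastLessThan_Suc_insert[of i \<tau>] image_atLeastLessThan_Suc_insert[of i \<sigma>]
      by simp
  qed
  have inv: "path_pair n (?U i) (?L i) \<and> M i = lpm n (?U i) (?L i)" if "i \<le> n" for i
    using that
  proof (induction i)
    case 0
    then show ?case using M0 by (simp add: path_pair_def)
  next
    case (Suc i)
    then show ?case using step[of "Suc i"] by simp
  qed
  show "good_steps n \<sigma> \<tau>"
    unfolding good_steps_def
  proof
    fix i assume i: "i \<in> {1..n}"
    then obtain j where "i = Suc j" by (cases i) auto
    then show "good (\<tau> ` {1..<i}) (\<sigma> ` {1..<i}) (\<tau> i) (\<sigma> i)"
      using step[OF i] inv[of j] i by simp
  qed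
next
  assume good: "good_steps n \<sigma> \<tau>"
  define M where "M i = lpm n (\<tau> ` {1..<Suc i}) (\<sigma> ` {1..<Suc i})" for i
  have ext: "good_extension n (\<tau> ` {1..<i}) (\<sigma> ` {1..<i}) (\<tau> i) (\<sigma> i)"
    if "i \<in> {1..n}" "path_pair n (\<tau> ` {1..<i}) (\<sigma> ` {1..<i})" for i
    using path_extension_image[OF \<sigma> \<tau> that] good that(1)
    by (simp add: good_extension_def good_extension_axioms_def good_steps_def)
  have pair: "path_pair n (\<tau> ` {1..<Suc i}) (\<sigma> ` {1..<Suc i})" if "i \<le> n" for i
    using that
  proof (induction i)
    case 0
    then show ?case by (simp add: path_pair_def)
  next
    case (Suc i)
    then interpret good_extension n "\<tau> ` {1..<Suc i}" "\<sigma> ` {1..<Suc i}" "\<tau> (Suc i)" "\<sigma> (Suc i)"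
      using ext[of "Suc i"] by simp
    show ?case
      using pair_insert[OF good] image_atLeastLessThan_Suc_insert[of "Suc i" \<tau>]
        image_atLeastLessThan_Suc_insert[of "Suc i" \<sigma>] by simp
  qed
  have cover: "cover_label n (M (i - 1)) (M i) (\<sigma> i, \<tau> i)" if i: "i \<in> {1..n}" for i
  proof -
    let ?U = "\<tau> ` {1..<i}" and ?L = "\<sigma> ` {1..<i}"
    have Suc: "Suc (i - 1) = i" using i by simp
    have p: "path_pair n ?U ?L" using pair[of "i - 1", unfolded Suc] i by (simp add: le_diff_conv)
    interpret good_extension n ?U ?L "\<tau> i" "\<sigma> i" by (rule ext[OF i p])
    have M: "M i = lpm n (insert (\<tau> i) ?U) (insert (\<sigma> i) ?L)" "M (i - 1) = lpm n ?U ?L"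
      using i image_atLeastLessThan_Suc_insert[of i \<tau>] image_atLeastLessThan_Suc_insert[of i \<sigma>]
      unfolding M_def Suc by simp_all
    have rem: "insert (\<tau> i) ?U - {\<tau> i} = ?U" "insert (\<sigma> i) ?L - {\<sigma> i} = ?L" using u l by auto
    show ?thesis
      unfolding M
      by (rule cover_labelI[of n "insert (\<tau> i) ?U" "\<tau> i" "insert (\<sigma> i) ?L" "\<sigma> i", unfolded rem,
            OF covered pair_insert[OF good] p insertI1 insertI1])
  qed
  have "maximal_chain n M"
    unfolding maximal_chain_def
  proof (intro conjI ballI)
    show "M 0 = lpm n {} {}" by (simp add: M_def)
    show "M n = lpm n {1..n} {1..n}"
      using permutes_image[OF \<sigma>] permutes_image[OF \<tau>]
      by (simp add: M_def atLeastLessThanSuc_atLeastAtMost)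
    show "covered_by n (M (i - 1)) (M i)" if "i \<in> {1..n}" for i
      using cover[OF that] by (simp add: cover_label_def)
  qed
  moreover have "label_sequence n M (perm_pair_seq n \<sigma> \<tau>)"
    unfolding label_sequence_def
  proof (intro conjI ballI)
    show "length (perm_pair_seq n \<sigma> \<tau>) = n" by (simp add: perm_pair_seq_def)
    show "cover_label n (M (i - 1)) (M i) (perm_pair_seq n \<sigma> \<tau> ! (i - 1))" if "i \<in> {1..n}" for i
      using cover[OF that] unfolding nth_perm_pair_seq[OF that] .
  qed
  ultimately show "\<exists>M. maximal_chain n M \<and> label_sequence n M (perm_pair_seq n \<sigma> \<tau>)" by blast
qed

lemma falling_perm_pair_seq:
  "falling (perm_pair_seq n \<sigma> \<tau>) \<longleftrightarrow> (\<forall>i\<in>{1..<n}. \<not> (\<sigma> i < \<sigma> (Suc i) \<and> \<tau> i < \<tau> (Suc i)))"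
proof -
  have "length (perm_pair_seq n \<sigma> \<tau>) = n" by (simp add: perm_pair_seq_def)
  moreover have "perm_pair_seq n \<sigma> \<tau> ! i = (\<sigma> (Suc i), \<tau> (Suc i))" if "i < n" for i
    using nth_perm_pair_seq[of "Suc i" n] that by simp
  ultimately have "falling (perm_pair_seq n \<sigma> \<tau>) \<longleftrightarrow>
      (\<forall>i. Suc i < n \<longrightarrow> \<not> (\<sigma> (Suc i) < \<sigma> (Suc (Suc i)) \<and> \<tau> (Suc i) < \<tau> (Suc (Suc i))))"
    unfolding falling_def by auto
  also have "\<dots> \<longleftrightarrow> (\<forall>i\<in>{1..<n}. \<not> (\<sigma> i < \<sigma> (Suc i) \<and> \<tau> i < \<tau> (Suc i)))"
    by (auto simp: Suc_le_eq) (metis Suc_less_eq Suc_pred)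
  finally show ?thesis .
qed

section \<open>Coxeter length as the number of inversions\<close>

definition inversions :: "nat \<Rightarrow> (nat \<Rightarrow> nat) \<Rightarrow> (nat \<times> nat) set" where
  "inversions n w = {(a, b). 1 \<le> a \<and> a < b \<and> b \<le> n \<and> w b < w a}"

lemma finite_inversions [simp]: "finite (inversions n w)"
  by (rule finite_subset[of _ "{1..n} \<times> {1..n}"]) (auto simp: inversions_def)

lemma simple_word_perm_Nil [simp]: "simple_word_perm [] = id"
  and simple_word_perm_Cons [simp]: "simple_word_perm (i # is) = transpose i (Suc i) \<circ> simple_word_perm is"
  by (simp_all add: simple_word_perm_def)

lemma simple_word_perm_Cons_comp:
  "simple_word_perm (i # is) \<circ> w = transpose i (Suc i) \<circ> (simple_word_perm is \<circ> w)"
  by (simp add: comp_assoc)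

text \<open>No value lies strictly between \<open>i\<close> and \<open>Suc i\<close>, so swapping
  them affects no comparison but their own.\<close>

lemma transpose_Suc_less_iff:
  assumes "{x, y} \<noteq> {i, Suc i}"
  shows "transpose i (Suc i) x < transpose i (Suc i) y \<longleftrightarrow> x < y"
  using assms by (auto simp: transpose_def)

lemma inversions_ascent:
  assumes w: "w permutes {1..n}" and ab: "a \<in> {1..n}" "b \<in> {1..n}" "a < b" and "w a = i" "w b = Suc i"
  shows "inversions n (transpose i (Suc i) \<circ> w) = insert (a, b) (inversions n w)" "(a, b) \<notin> inversions n w"
proof -
  have inj: "w x = w y \<longleftrightarrow> x = y" for x y using permutes_inj[OF w] by (auto dest: injD)
  have "(x, y) \<in> inversions n (transpose i (Suc i) \<circ> w) \<longleftrightarrow> (x, y) \<in> insert (a, b) (inversions n w)" for x y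
  proof (cases "{w y, w x} = {i, Suc i}")
    case True
    then have "x = a \<and> y = b \<or> x = b \<and> y = a"
      using assms(5,6) inj[of x a] inj[of x b] inj[of y a] inj[of y b] by (auto simp: doubleton_eq_iff)
    then show ?thesis using assms by (auto simp: inversions_def)
  next
    case False
    then have "(x, y) \<noteq> (a, b)" using assms(5,6) by auto
    then show ?thesis using transpose_Suc_less_iff[OF False] by (auto simp: inversions_def)
  qed
  then show "inversions n (transpose i (Suc i) \<circ> w) = insert (a, b) (inversions n w)" by auto
  show "(a, b) \<notin> inversions n w" using assms by (simp add: inversions_def)
qed

lemma permutes_transpose_comp:
  assumes "w permutes {1..n}" "i \<in> {1..<n}"
  shows "transpose i (Suc i) \<circ> w permutes {1..n}"
  using assms by (intro permutes_compose permutes_swap_id) auto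

text \<open>\<open>inv w i\<close> is the position of the value \<open>i\<close>. The second claim
  is the ascent case for the swapped permutation, from which a further swap returns to
  \<open>w\<close>.\<close>

lemma card_inversions_transpose:
  assumes w: "w permutes {1..n}" and i: "i \<in> {1..<n}"
  shows "inv w i < inv w (Suc i) \<Longrightarrow> card (inversions n (transpose i (Suc i) \<circ> w)) = Suc (card (inversions n w))"
    and "inv w (Suc i) < inv w i \<Longrightarrow> Suc (card (inversions n (transpose i (Suc i) \<circ> w))) = card (inversions n w)"
proof -
  have eq: "w (inv w x) = x" for x using permutes_inverses[OF w] by simp
  have mem: "inv w i \<in> {1..n}" "inv w (Suc i) \<in> {1..n}"
    using permutes_in_image[OF permutes_inv[OF w]] i by auto
  show "card (inversions n (transpose i (Suc i) \<circ> w)) = Suc (card (inversions n w))"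
    if "inv w i < inv w (Suc i)"
    using inversions_ascent[OF w mem that eq eq] by simp
  show "Suc (card (inversions n (transpose i (Suc i) \<circ> w))) = card (inversions n w)"
    if "inv w (Suc i) < inv w i"
  proof -
    let ?v = "transpose i (Suc i) \<circ> w"
    have "transpose i (Suc i) \<circ> ?v = w" by (simp add: fun_eq_iff)
    moreover have "?v (inv w (Suc i)) = i" "?v (inv w i) = Suc i" using eq by simp_all
    note inversions_ascent[OF permutes_transpose_comp[OF w i] mem(2,1) that this]
    ultimately have "inversions n w = insert (inv w (Suc i), inv w i) (inversions n ?v)"
      "(inv w (Suc i), inv w i) \<notin> inversions n ?v"
      by metis+
    then show ?thesis by simp
  qed
qed

lemma card_inversions_transpose_le:
  assumes "w permutes {1..n}" "i \<in> {1..<n}"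
  shows "card (inversions n (transpose i (Suc i) \<circ> w)) \<le> Suc (card (inversions n w))"
proof -
  have "inv w i \<noteq> inv w (Suc i)"
    using permutes_inj[OF permutes_inv[OF assms(1)]] by (metis injD n_not_Suc_n)
  then show ?thesis using card_inversions_transpose[OF assms] by (cases "inv w i < inv w (Suc i)") auto
qed

lemma simple_word_perm_permutes:
  assumes "set is \<subseteq> {1..<n}" "w permutes {1..n}"
  shows "simple_word_perm is \<circ> w permutes {1..n}"
  using assms(1)
proof (induction "is")
  case Nil
  then show ?case using assms(2) by simp
next
  case (Cons i "is")
  then have "set is \<subseteq> {1..<n}" "i \<in> {1..<n}" by auto
  then show ?case
    unfolding simple_word_perm_Cons_comp by (intro permutes_transpose_comp Cons.IH)
qed

lemma card_inversions_word_le: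
  assumes "set is \<subseteq> {1..<n}" "w permutes {1..n}"
  shows "card (inversions n (simple_word_perm is \<circ> w)) \<le> card (inversions n w) + length is"
  using assms(1)
proof (induction "is")
  case (Cons i "is")
  then have set: "set is \<subseteq> {1..<n}" "i \<in> {1..<n}" by auto
  show ?case
    using card_inversions_transpose_le[OF simple_word_perm_permutes[OF set(1) assms(2)] set(2)] Cons.IH[OF set(1)]
    unfolding simple_word_perm_Cons_comp by (simp only: list.size)
qed simp

lemma permutes_no_descent_id:
  assumes w: "w permutes {1..n}" and asc: "\<And>i. i \<in> {1..<n} \<Longrightarrow> w i < w (Suc i)"
  shows "w = id"
proof -
  have ge: "x \<le> w x" if "x \<le> n" for x
    using that
  proof (induction x)
    case (Suc x)
    then show ?case using asc[of x] permutes_in_image[OF w, of "Suc x"] by (cases "x = 0") auto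
  qed simp
  have le: "w x \<le> x" if "x \<le> n" "x \<ge> 1" for x
    using that
  proof (induction "n - x" arbitrary: x)
    case 0
    then show ?case using permutes_in_image[OF w, of x] by auto
  next
    case (Suc k)
    then have "w (Suc x) \<le> Suc x" "x \<in> {1..<n}" by auto
    then show ?case using asc[of x] by simp
  qed
  show ?thesis
  proof
    fix x show "w x = id x"
      using ge[of x] le[of x] permutes_not_in[OF w, of x] by (cases "x \<in> {1..n}") auto
  qed
qed

text \<open>If \<open>Suc i\<close> stands before \<open>i\<close> for some \<open>i\<close>,
  swapping them loses an inversion and the induction applies. Otherwise \<open>inv w\<close> is
  increasing, so \<open>w = id\<close>.\<close>

lemma obtain_reduced_word:
  assumes "w permutes {1..n}"
  obtains "is" where "length is = card (inversions n w)" "set is \<subseteq> {1..<n}" "w = simple_word_perm is"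
proof -
  have "\<exists>is. length is = card (inversions n w) \<and> set is \<subseteq> {1..<n} \<and> w = simple_word_perm is"
    using assms
  proof (induction "card (inversions n w)" arbitrary: w rule: less_induct)
    case less
    show ?case
    proof (cases "\<exists>i\<in>{1..<n}. inv w (Suc i) < inv w i")
      case True
      then obtain i where i: "i \<in> {1..<n}" "inv w (Suc i) < inv w i" by blast
      let ?v = "transpose i (Suc i) \<circ> w"
      have c: "Suc (card (inversions n ?v)) = card (inversions n w)"
        using card_inversions_transpose(2)[OF less.prems i] .
      then obtain "is" where "is": "length is = card (inversions n ?v)" "set is \<subseteq> {1..<n}" "?v = simple_word_perm is"
        using less.hyps[OF _ permutes_transpose_comp[OF less.prems i(1)]] by auto
      have "w = transpose i (Suc i) \<circ> ?v" by (simp add: fun_eq_iff)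
      then show ?thesis using "is" c i(1) by (intro exI[of _ "i # is"]) simp
    next
      case False
      have "inv w i < inv w (Suc i)" if "i \<in> {1..<n}" for i
        using False that permutes_inj[OF permutes_inv[OF less.prems]]
        by (metis injD linorder_neqE_nat n_not_Suc_n)
      then have "inv w = id" using permutes_no_descent_id[OF permutes_inv[OF less.prems]] by blast
      then have "w = id" using permutes_inv_inv[OF less.prems] inv_id by metis
      moreover have "inversions n id = {}" by (auto simp: inversions_def)
      ultimately show ?thesis by (intro exI[of _ "[]"]) simp
    qed
  qed
  then show ?thesis using that by blast
qed

lemma coxeter_length_eq_card_inversions:
  assumes "w permutes {1..n}"
  shows "coxeter_length n w = card (inversions n w)"
  unfolding coxeter_length_def
proof (rule Least_equality)
  show "\<exists>is. length is = card (inversions n w) \<and> set is \<subseteq> {1..<n} \<and> w = simple_word_perm is"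
    using obtain_reduced_word[OF assms] by metis
next
  fix k assume "\<exists>is. length is = k \<and> set is \<subseteq> {1..<n} \<and> w = simple_word_perm is"
  then obtain "is" where "is": "length is = k" "set is \<subseteq> {1..<n}" "w = simple_word_perm is" by blast
  have "inversions n id = {}" by (auto simp: inversions_def)
  then show "card (inversions n w) \<le> k"
    using card_inversions_word_le[OF "is"(2) permutes_id] "is" by simp
qed

text \<open>Each letter adds at most one inversion, but the total gain equals the number of letters.
  So no letter may lose one, and each acts while \<open>i\<close> stands before
  \<open>Suc i\<close>.\<close>

lemma left_weak_le_induct [consumes 2, case_names refl ascent]:
  assumes \<sigma>: "\<sigma> permutes {1..n}" and "left_weak_le n \<sigma> \<sigma>'"
    and refl: "P \<sigma>"
    and ascent: "\<And>w i. \<lbrakk>w permutes {1..n}; i \<in> {1..<n}; inv w i < inv w (Suc i); P w\<rbrakk>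
      \<Longrightarrow> P (transpose i (Suc i) \<circ> w)"
  shows "P \<sigma>'"
proof -
  obtain "is" where "is": "set is \<subseteq> {1..<n}" "\<sigma>' = simple_word_perm is \<circ> \<sigma>"
    "coxeter_length n \<sigma>' = coxeter_length n \<sigma> + length is"
    using assms(2) unfolding left_weak_le_def by blast
  have "card (inversions n (simple_word_perm is \<circ> \<sigma>)) = card (inversions n \<sigma>) + length is"
    using "is"(3) unfolding "is"(2)
    using coxeter_length_eq_card_inversions[OF \<sigma>]
      coxeter_length_eq_card_inversions[OF simple_word_perm_permutes[OF "is"(1) \<sigma>]] by simp
  with "is"(1) have "P (simple_word_perm is \<circ> \<sigma>)"
  proof (induction "is")
    case Nil
    then show ?case using refl by simp
  next
    case (Cons i "is")
    let ?w = "simple_word_perm is \<circ> \<sigma>"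
    have set: "set is \<subseteq> {1..<n}" and i: "i \<in> {1..<n}" using Cons.prems(1) by auto
    have w: "?w permutes {1..n}" by (rule simple_word_perm_permutes[OF set \<sigma>])
    have len: "card (inversions n (transpose i (Suc i) \<circ> ?w)) = Suc (card (inversions n \<sigma>) + length is)"
      using Cons.prems(2) unfolding simple_word_perm_Cons_comp by (simp only: length_Cons add_Suc_right)
    have le: "card (inversions n ?w) \<le> card (inversions n \<sigma>) + length is"
      by (rule card_inversions_word_le[OF set \<sigma>])
    have "inv ?w i \<noteq> inv ?w (Suc i)"
      using permutes_inj[OF permutes_inv[OF w]] by (metis injD n_not_Suc_n)
    then have asc: "inv ?w i < inv ?w (Suc i)"
      using card_inversions_transpose(2)[OF w i] len le by linarith
    then have "card (inversions n ?w) = card (inversions n \<sigma>) + length is"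
      using card_inversions_transpose(1)[OF w i] len by simp
    then have "P ?w" using Cons.IH set by blast
    from ascent[OF w i asc this] show ?case unfolding simple_word_perm_Cons_comp .
  qed
  then show ?thesis using "is"(2) by simp
qed

section \<open>Ascending in the left weak order\<close>

text \<open>For such \<open>l\<close>, \<open>i \<le> l\<close> and \<open>Suc i \<le> l\<close> are
  equivalent, so the heights at \<open>l\<close> agree.\<close>

lemma good_insert_transpose:
  assumes "i \<notin> S" "Suc i \<notin> S" and l: "l \<noteq> i" "l \<noteq> Suc i"
  shows "good U (insert (Suc i) S) u l \<longleftrightarrow> good U (insert i S) u l"
  using assms by (auto simp: good_def cnt_insert)

context
  fixes n i :: nat and w \<tau> :: "nat \<Rightarrow> nat"
  assumes w: "w permutes {1..n}" and i: "i \<in> {1..<n}" and asc: "inv w i < inv w (Suc i)"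
begin

text \<open>Two steps matter. At the position of \<open>i\<close> the label grows by one while the
  height stays, which relaxes the second inequality. At that of \<open>Suc i\<close> the label and
  the height both drop by one, which relaxes the first and preserves the second. The implication is
  thus one-way.\<close>

lemma good_steps_ascent:
  assumes "good_steps n w \<tau>"
  shows "good_steps n (transpose i (Suc i) \<circ> w) \<tau>"
  unfolding good_steps_def
proof
  fix r assume r: "r \<in> {1..n}"
  let ?t = "transpose i (Suc i)" and ?a = "inv w i" and ?b = "inv w (Suc i)"
  let ?U = "\<tau> ` {1..<r}" and ?L = "w ` {1..<r}"
  have old: "good ?U ?L (\<tau> r) (w r)" using assms r by (simp add: good_steps_def)
  have wi: "w ?a = i" "w ?b = Suc i" using permutes_inverses(1)[OF w] by simp_all
  have eq: "w x = y \<longleftrightarrow> x = inv w y" for x y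
    using permutes_inv_eq[OF w, of y x] by auto
  have ab: "1 \<le> ?a" "1 \<le> ?b" using permutes_in_image[OF permutes_inv[OF w]] i
    by (metis atLeastAtMost_iff atLeastLessThan_iff less_imp_le Suc_leI le_Suc_eq)+
  have mem: "i \<in> ?L \<longleftrightarrow> ?a < r" "Suc i \<in> ?L \<longleftrightarrow> ?b < r"
    using inj_image_mem_iff[OF permutes_inj[OF w], of ?a "{1..<r}"]
      inj_image_mem_iff[OF permutes_inj[OF w], of ?b "{1..<r}"] ab unfolding wi by simp_all
  have img: "(?t \<circ> w) ` {1..<r} = ?t ` ?L" by (simp add: image_comp)
  consider "r < ?a" | "r = ?a" | "?a < r" "r < ?b" | "r = ?b" | "?b < r" by linarith
  then have "good ?U (?t ` ?L) (\<tau> r) (?t (w r))"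
  proof cases
    case 1
    then have "?t ` ?L = ?L" using mem asc by (intro transpose_image_eq) auto
    moreover have "?t (w r) = w r" using 1 asc eq by (intro transpose_apply_other) auto
    ultimately show ?thesis using old by simp
  next
    case 2
    then have "?t ` ?L = ?L" "Suc i \<notin> ?L" using mem asc by (auto intro!: transpose_image_eq)
    moreover have "?t (w r) = Suc i" "w r = i" using 2 wi by simp_all
    ultimately show ?thesis using old by (simp add: good_def cnt_Suc)
  next
    case 3
    then have "i \<in> ?L" "Suc i \<notin> ?L" using mem by simp_all
    then obtain S where S: "?L = insert i S" "i \<notin> S" "Suc i \<notin> S"
      using mk_disjoint_insert insertI2 by metis
    have r: "w r \<noteq> i" "w r \<noteq> Suc i" using 3 eq by auto
    show ?thesis
      using old good_insert_transpose[OF S(2,3) r] r S(2,3) unfolding S(1) by simp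
  next
    case 4
    then have "i \<in> ?L" "Suc i \<notin> ?L" using mem asc by simp_all
    then obtain S where S: "?L = insert i S" "i \<notin> S" "Suc i \<notin> S"
      using mk_disjoint_insert insertI2 by metis
    have r: "w r = Suc i" using 4 wi by simp
    \<comment> \<open>The earlier \<open>i\<close> counts at height \<open>Suc i\<close>; the
      \<open>Suc i\<close> replacing it does not count at \<open>i\<close>.\<close>
    have "cnt (insert i S) (Suc i) = Suc (cnt S i)" "cnt (insert (Suc i) S) i = cnt S i"
      using S(2,3) by (simp_all add: cnt_insert cnt_Suc)
    then show ?thesis using old S(2,3) unfolding S(1) r by (simp add: good_def)
  next
    case 5
    then have L: "i \<in> ?L" "Suc i \<in> ?L" using mem asc by auto
    then have "?t ` ?L = ?L" by (intro transpose_image_eq) auto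
    moreover have "?t (w r) = w r" using 5 asc eq by (intro transpose_apply_other) auto
    ultimately show ?thesis using old by simp
  qed
  then show "good ?U ((?t \<circ> w) ` {1..<r}) (\<tau> r) ((?t \<circ> w) r)" unfolding img by simp
qed

text \<open>The swap creates no ascent between neighbouring positions: the only comparison it
  changes is one where \<open>i\<close> came first, and that was an ascent already.\<close>

lemma falling_ascent:
  assumes "falling (perm_pair_seq n w \<tau>)"
  shows "falling (perm_pair_seq n (transpose i (Suc i) \<circ> w) \<tau>)"
  unfolding falling_perm_pair_seq
proof (intro ballI notI)
  fix j assume j: "j \<in> {1..<n}"
    and *: "(transpose i (Suc i) \<circ> w) j < (transpose i (Suc i) \<circ> w) (Suc j) \<and> \<tau> j < \<tau> (Suc j)"
  have "w j < w (Suc j)"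
  proof (cases "{w j, w (Suc j)} = {i, Suc i}")
    case True
    have "w (Suc j) \<noteq> i"
    proof
      assume "w (Suc j) = i"
      with True have "w j = Suc i" by (auto simp: doubleton_eq_iff)
      then have "inv w i = Suc j" "inv w (Suc i) = j"
        using \<open>w (Suc j) = i\<close> permutes_inverses(2)[OF w] by metis+
      then show False using asc by simp
    qed
    then show ?thesis using True by (auto simp: doubleton_eq_iff)
  next
    case False
    then show ?thesis using * transpose_Suc_less_iff by simp
  qed
  then show False using assms j * unfolding falling_perm_pair_seq by blast
qed

end

lemma perm_pair_seq_inject:
  assumes "\<tau> permutes {1..n}" "\<tau>' permutes {1..n}" "perm_pair_seq n \<sigma> \<tau> = perm_pair_seq n \<sigma> \<tau>'"
  shows "\<tau> = \<tau>'"
proof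
  fix x show "\<tau> x = \<tau>' x"
  proof (cases "x \<in> {1..n}")
    case True
    then show ?thesis using assms(3) nth_perm_pair_seq by (metis prod.inject)
  next
    case False
    then show ?thesis using permutes_not_in[OF assms(1)] permutes_not_in[OF assms(2)] by metis
  qed
qed

text \<open>Sequences over different first permutations are never the same objects; passing to the
  \<open>\<tau>\<close> alone lets the classes be compared by inclusion.\<close>

lemma card_falling_class:
  assumes "\<sigma> permutes {1..n}"
  shows "card (falling_class n \<sigma>) =
    card {\<tau>. \<tau> permutes {1..n} \<and> good_steps n \<sigma> \<tau> \<and> falling (perm_pair_seq n \<sigma> \<tau>)}"
    (is "_ = card ?T")
proof -
  have "falling_class n \<sigma> = perm_pair_seq n \<sigma> ` ?T"
    using ex_maximal_chain_iff_good_steps[OF assms] unfolding falling_class_def by auto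
  moreover have "inj_on (perm_pair_seq n \<sigma>) ?T"
    using perm_pair_seq_inject by (auto intro!: inj_onI)
  ultimately show ?thesis by (simp add: card_image)
qed

theorem theorem3p17:
  fixes n :: nat and \<sigma> \<sigma>' :: "nat \<Rightarrow> nat"
  assumes "n \<ge> 1"
    and "\<sigma> permutes {1..n}" and "\<sigma>' permutes {1..n}"
    and "left_weak_le n \<sigma> \<sigma>'"
  shows "card (falling_class n \<sigma>) \<le> card (falling_class n \<sigma>')"
proof -
  have "good_steps n \<sigma>' \<tau> \<and> falling (perm_pair_seq n \<sigma>' \<tau>)"
    if "good_steps n \<sigma> \<tau>" "falling (perm_pair_seq n \<sigma> \<tau>)" for \<tau>
    using assms(2,4)
  proof (induction rule: left_weak_le_induct)
    case refl
    then show ?case using that by simp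
  next
    case (ascent w i)
    then show ?case using good_steps_ascent falling_ascent by blast
  qed
  then have "{\<tau>. \<tau> permutes {1..n} \<and> good_steps n \<sigma> \<tau> \<and> falling (perm_pair_seq n \<sigma> \<tau>)}
      \<subseteq> {\<tau>. \<tau> permutes {1..n} \<and> good_steps n \<sigma>' \<tau> \<and> falling (perm_pair_seq n \<sigma>' \<tau>)}" by blast
  moreover have "finite {\<tau>. \<tau> permutes {1..n} \<and> good_steps n \<sigma>' \<tau> \<and> falling (perm_pair_seq n \<sigma>' \<tau>)}"
    by (rule finite_subset[OF _ finite_permutations[of "{1..n}"]]) auto
  ultimately show ?thesis
    unfolding card_falling_class[OF assms(2)] card_falling_class[OF assms(3)] by (rule card_mono[rotated])
qed

end
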